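(* There exists an absolute constant $c>0$ such that for every integer $n\geq 1$, every symmetric isotropic convex body $K\subseteq\mathbb{R}^n$ and every real $t$ with $1\leq t\leq\frac{\sqrt n}{c}$, $$ F(t)\geq e^{-c^2t^2}, $$ where $$ F(t)=\int_{S^{n-1}}|\{x\in K : |\langle x,\theta\rangle|\geq tL_K\}|\,d\sigma(\theta). $$
   Context: A convex body $K\subset\mathbb{R}^n$ is a compact convex set with non-empty interior; it is symmetric if $-x\in K$ whenever $x\in K$. For a set, $|\cdot|$ denotes Lebesgue measure on $\mathbb{R}^n$; $\langle\cdot,\cdot\rangle$ is the standard scalar product, $S^{n-1}$ the Euclidean unit sphere, and $\sigma$ the uniform probability measure on $S^{n-1}$. A convex body $K$ is isotropic if $|K|=1$, $\int_K x\,dx=0$, and there is a constant $L_K>0$ (the isotropic constant of $K$) such that $\int_K\langle x,\theta\rangle^2\,dx=L_K^2$ for all $\theta\in S^{n-1}$. "Absolute constant" means independent of $n$, $K$ and $t$. *)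

theory Defs
  imports "HOL-Probability.Probability"
begin

text \<open>
  The dimension \<open>n\<close> is quantified inside the scope of an absolute constant, so it cannot be a type.
  Points of \<open>\<real>\<^sup>n\<close> are the extensional functions in \<open>{..<n} \<rightarrow>\<^sub>E (UNIV :: real set)\<close>, which is both the
  space of the product measure \<open>PiM {..<n} (\<lambda>_. lborel)\<close> and the carrier of the product topology.
\<close>

definition euclidean_top :: "nat \<Rightarrow> (nat \<Rightarrow> real) topology" where
  "euclidean_top n = product_topology (\<lambda>_. euclideanreal) {..<n}"

text \<open>
  Lebesgue measure on the Borel sets. It is not completed; compact sets are Borel, so this
  makes no difference for convex bodies.
\<close>

definition lebesgue_n :: "nat \<Rightarrow> (nat \<Rightarrow> real) measure" where
  "lebesgue_n n = (\<Pi>\<^sub>M i\<in>{..<n}. lborel)"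

definition inner_n :: "nat \<Rightarrow> (nat \<Rightarrow> real) \<Rightarrow> (nat \<Rightarrow> real) \<Rightarrow> real" where
  "inner_n n x y = (\<Sum>i<n. x i * y i)"

abbreviation norm_n :: "nat \<Rightarrow> (nat \<Rightarrow> real) \<Rightarrow> real" where
  "norm_n n x \<equiv> L2_set x {..<n}"

definition convex_n :: "nat \<Rightarrow> (nat \<Rightarrow> real) set \<Rightarrow> bool" where
  "convex_n n K \<longleftrightarrow>
     (\<forall>x\<in>K. \<forall>y\<in>K. \<forall>u\<in>{0..1}. (\<lambda>i\<in>{..<n}. (1 - u) * x i + u * y i) \<in> K)"

definition convex_body :: "nat \<Rightarrow> (nat \<Rightarrow> real) set \<Rightarrow> bool" where
  "convex_body n K \<longleftrightarrow>
     compactin (euclidean_top n) K \<and> convex_n n K \<and> euclidean_top n interior_of K \<noteq> {}"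

definition symmetric_body :: "nat \<Rightarrow> (nat \<Rightarrow> real) set \<Rightarrow> bool" where
  "symmetric_body n K \<longleftrightarrow> (\<forall>x\<in>K. (\<lambda>i\<in>{..<n}. - x i) \<in> K)"

definition unit_sphere :: "nat \<Rightarrow> (nat \<Rightarrow> real) set" where
  "unit_sphere n = {x \<in> {..<n} \<rightarrow>\<^sub>E UNIV. norm_n n x = 1}"

definition punctured_ball :: "nat \<Rightarrow> (nat \<Rightarrow> real) set" where
  "punctured_ball n = {x \<in> {..<n} \<rightarrow>\<^sub>E UNIV. 0 < norm_n n x \<and> norm_n n x \<le> 1}"

text \<open>
  The uniform probability measure on the sphere, as the cone measure: the distribution of
  \<open>x / |x|\<close> for \<open>x\<close> uniform in the unit ball. The origin, a null set for \<open>n \<ge> 1\<close>, is removed so that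
  the radial projection takes values in the sphere everywhere.
\<close>

definition sphere_measure :: "nat \<Rightarrow> (nat \<Rightarrow> real) measure" where
  "sphere_measure n =
     distr (restrict_space (uniform_measure (lebesgue_n n) (punctured_ball n)) (punctured_ball n))
           (restrict_space (lebesgue_n n) (unit_sphere n))
           (\<lambda>x. \<lambda>i\<in>{..<n}. x i / norm_n n x)"

definition is_isotropic_constant :: "nat \<Rightarrow> (nat \<Rightarrow> real) set \<Rightarrow> real \<Rightarrow> bool" where
  "is_isotropic_constant n K L \<longleftrightarrow>
     L > 0 \<and> (\<forall>\<theta>\<in>unit_sphere n. (LINT x:K|lebesgue_n n. (inner_n n x \<theta>)\<^sup>2) = L\<^sup>2)"

definition isotropic :: "nat \<Rightarrow> (nat \<Rightarrow> real) set \<Rightarrow> bool" where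
  "isotropic n K \<longleftrightarrow>
     convex_body n K \<and> measure (lebesgue_n n) K = 1 \<and>
     (\<forall>i<n. (LINT x:K|lebesgue_n n. x i) = 0) \<and>
     (\<exists>L. is_isotropic_constant n K L)"

definition isotropic_constant :: "nat \<Rightarrow> (nat \<Rightarrow> real) set \<Rightarrow> real" where
  "isotropic_constant n K = (THE L. is_isotropic_constant n K L)"

definition avg_tail :: "nat \<Rightarrow> (nat \<Rightarrow> real) set \<Rightarrow> real \<Rightarrow> real" where
  "avg_tail n K t =
     (\<integral>\<theta>. measure (lebesgue_n n)
            {x \<in> K. \<bar>inner_n n x \<theta>\<bar> \<ge> t * isotropic_constant n K} \<partial>sphere_measure n)"

lemma unit_sphere_nonempty:
  assumes "n \<ge> 1"
  shows "unit_sphere n \<noteq> {}"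
proof -
  have "(\<Sum>i<n. (if i = 0 then 1 else 0 :: real)\<^sup>2) = (\<Sum>i<n. if i = 0 then 1 else 0)"
    by (intro sum.cong) auto
  also have "\<dots> = 1"
    using assms by simp
  finally have "norm_n n (\<lambda>i\<in>{..<n}. if i = 0 then 1 else 0) = 1"
    by (simp add: L2_set_def)
  then have "(\<lambda>i\<in>{..<n}. if i = 0 then 1 else 0) \<in> unit_sphere n"
    by (simp add: unit_sphere_def)
  then show ?thesis by blast
qed

lemma isotropic_constant_eq:
  assumes "n \<ge> 1" "is_isotropic_constant n K L"
  shows "isotropic_constant n K = L"
proof -
  obtain \<theta> where \<theta>: "\<theta> \<in> unit_sphere n"
    using unit_sphere_nonempty[OF assms(1)] by blast
  have uniq: "L' = L" if L': "is_isotropic_constant n K L'" for L'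
  proof -
    have "L'\<^sup>2 = (LINT x:K|lebesgue_n n. (inner_n n x \<theta>)\<^sup>2)"
      using L'[unfolded is_isotropic_constant_def, THEN conjunct2, THEN bspec, OF \<theta>] by (rule sym)
    also have "\<dots> = L\<^sup>2"
      by (rule assms(2)[unfolded is_isotropic_constant_def, THEN conjunct2, THEN bspec, OF \<theta>])
    finally have eq: "L'\<^sup>2 = L\<^sup>2" .
    have "L' > 0" "L > 0"
      using L' assms(2) unfolding is_isotropic_constant_def by (blast, blast)
    then show ?thesis
      by (intro power2_eq_imp_eq[OF eq] less_imp_le)
  qed
  show ?thesis
    unfolding isotropic_constant_def
    by (rule the_equality[where P = "is_isotropic_constant n K", OF assms(2) uniq])
qed

end

theory Submission
  imports Defs
begin

text \<open>
  Write \<open>L\<close> for the isotropic constant of \<open>K\<close>, \<open>B\<close> for the unit ball, \<open>\<langle>x, y\<rangle>\<close> for the inner product.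
  The average over the sphere is an average over \<open>y \<in> B\<close> with \<open>y / norm y\<close> as direction, so \<open>F(t)\<close> is the
  probability that \<open>\<bar>\<langle>x, y\<rangle>\<bar> \<ge> t * L * norm y\<close> for independent uniform \<open>x \<in> K\<close> and \<open>y \<in> B\<close>. As
  \<open>norm y \<le> 1\<close>, it suffices to bound the probability of \<open>\<bar>\<langle>x, y\<rangle>\<bar> \<ge> t * L\<close> from below.

  Two facts say that a typical pair is ordinary. For each \<open>y \<in> B\<close>, isotropy and Chebyshev's inequality show
  that \<open>\<bar>\<langle>x, y\<rangle>\<bar> \<le> 9 * L\<close> except for \<open>x\<close> in a set of measure at most \<open>1/81\<close> (\<open>slab_complement_small\<close>).
  And \<open>norm x > sqrt n * L / 2\<close> on a set of measure greater than \<open>1/36\<close> (\<open>mass_outside_large\<close>). The second fact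
  uses convexity: the mean of \<open>norm x ^ 2\<close> over \<open>K\<close> is \<open>n * L\<^sup>2\<close>, and this mean cannot come from a small
  set of very long vectors, because by Borell's argument (\<open>borell_step\<close>) the measure outside the ball of
  radius \<open>3 * r\<close> is at most of the order of the square of the measure outside the ball of radius \<open>r\<close>. Borell's
  argument is an application of the Brunn--Minkowski inequality
  \<open>|A| * |B| \<le> |(A + B) / 2| ^ 2\<close>, proved here via the functional inequality of Prekopa and Leindler, whose
  dimension-free form allows induction on the dimension (\<open>prekopa_leindler_midpoint\<close>).

  So at least the fraction \<open>1/36 - 1/81\<close> of all pairs \<open>(x, y)\<close> has \<open>norm x > sqrt n * L / 2\<close> and
  \<open>\<bar>\<langle>x, y\<rangle>\<bar> \<le> 9 * L\<close>. For fixed \<open>x\<close>, replace \<open>y\<close> by \<open>\<rho> * y + a * x / norm x\<close> with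
  \<open>a = 20 * t / sqrt n\<close>. The new point has inner product at least \<open>t * L\<close> with \<open>x\<close>, and for
  \<open>\<rho>\<^sup>2 = 1 - 3 * a\<^sup>2\<close> it stays in \<open>B\<close> (\<open>displaced_ball_point\<close>). The replacement multiplies volume by
  \<open>\<rho> ^ n = (1 - 1200 * t\<^sup>2 / n) ^ (n/2) \<ge> exp (- 1200 * t\<^sup>2)\<close>, where \<open>t \<le> sqrt n / 50\<close> keeps
  \<open>1200 * t\<^sup>2 / n\<close> below \<open>1/2\<close>. As \<open>t \<ge> 1\<close>, the fraction \<open>1/36 - 1/81\<close> is at least \<open>exp (- 1300 * t\<^sup>2)\<close>, and
  \<open>c = 50\<close> works.
\<close>

section \<open>The Prekopa--Leindler inequality for midpoints\<close>

text \<open>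
  The one-dimensional Brunn--Minkowski inequality. For \<open>a \<in> A\<close> and \<open>b \<in> B\<close> the set of sums
  \<open>A + B\<close> contains the translate by \<open>b\<close> of the part of \<open>A\<close> to the left of \<open>a\<close> and the translate
  by \<open>a\<close> of the part of \<open>B\<close> to the right of \<open>b\<close>. These lie on opposite sides of \<open>a + b\<close>, so
  their measures add up. Pushing \<open>a\<close> towards the right end of \<open>A\<close> and \<open>b\<close> towards the left end of
  \<open>B\<close> exhausts both sets.
\<close>

lemma emeasure_add_le_midpoints:
  fixes A B C :: "real set"
  assumes [measurable]: "A \<in> sets borel" "B \<in> sets borel" "C \<in> sets borel"
    and mid: "\<And>a b. a \<in> A \<Longrightarrow> b \<in> B \<Longrightarrow> (a + b) / 2 \<in> C"
    and ne: "A \<noteq> {}" "B \<noteq> {}"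
  shows "emeasure lborel A + emeasure lborel B \<le> 2 * emeasure lborel C"
proof -
  \<comment> \<open>Everything is halved, which scales measure by 2: the two indicators below are those of the
    two translates, and they overlap only at the midpoint of \<open>a\<close> and \<open>b\<close>.\<close>
  have half: "emeasure lborel (A \<inter> {..a}) + emeasure lborel (B \<inter> {b..}) \<le> 2 * emeasure lborel C"
    if "a \<in> A" "b \<in> B" for a b
  proof -
    let ?f = "\<lambda>x. indicator (A \<inter> {..a}) (- b + 2 * x) + indicator (B \<inter> {b..}) (- a + 2 * x) :: ennreal"
    have ae: "AE x in lborel. x \<noteq> (a + b) / 2"
      by (rule AE_lborel_singleton)
    have "emeasure lborel (A \<inter> {..a}) + emeasure lborel (B \<inter> {b..})
        = 2 * (\<integral>\<^sup>+x. indicator (A \<inter> {..a}) (- b + 2 * x) \<partial>lborel)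
          + 2 * (\<integral>\<^sup>+x. indicator (B \<inter> {b..}) (- a + 2 * x) \<partial>lborel)"
      using nn_integral_real_affine[of "indicator (A \<inter> {..a})" 2 "- b"]
        nn_integral_real_affine[of "indicator (B \<inter> {b..})" 2 "- a"] by simp
    also have "\<dots> = 2 * (\<integral>\<^sup>+x. ?f x \<partial>lborel)"
      by (subst nn_integral_add) (auto simp: distrib_left)
    also have "\<dots> \<le> 2 * (\<integral>\<^sup>+x. indicator C x \<partial>lborel)"
    proof (intro mult_left_mono nn_integral_mono_AE, use ae in eventually_elim)
      fix x assume x: "x \<noteq> (a + b) / 2"
      have 1: "x \<in> C" if "- b + 2 * x \<in> A" using mid[OF that \<open>b \<in> B\<close>] by simp
      have 2: "x \<in> C" if "- a + 2 * x \<in> B" using mid[OF \<open>a \<in> A\<close> that] by simp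
      show "?f x \<le> indicator C x"
        using x 1 2 by (auto simp: indicator_def)
    qed simp
    finally show ?thesis by simp
  qed
  \<comment> \<open>Suprema and infima need bounded sets, so both sets are first cut down to \<open>{-k..k}\<close>.\<close>
  have bounded: "emeasure lborel (A \<inter> {-real k..real k}) + emeasure lborel (B \<inter> {-real k..real k})
      \<le> 2 * emeasure lborel C"
    if nonempty: "A \<inter> {-real k..real k} \<noteq> {}" "B \<inter> {-real k..real k} \<noteq> {}" for k :: nat
  proof -
    let ?A = "A \<inter> {-real k..real k}" and ?B = "B \<inter> {-real k..real k}"
    have bdd: "bdd_above ?A" "bdd_below ?B" by (auto intro: bdd_above_mono bdd_below_mono)
    show ?thesis
    proof (rule ennreal_le_epsilon)
      fix e :: real assume e: "0 < e"
      obtain a where a: "a \<in> ?A" "Sup ?A - e/2 < a"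
        using less_cSup_iff[of ?A "Sup ?A - e/2"] nonempty bdd(1) e by (meson less_add_same_cancel1 diff_less_eq half_gt_zero less_add_same_cancel2)
      obtain b where b: "b \<in> ?B" "b < Inf ?B + e/2"
        using cInf_less_iff[of ?B "Inf ?B + e/2"] nonempty bdd(2) e by (meson less_add_same_cancel1 half_gt_zero)
      have "?A \<subseteq> (A \<inter> {..a}) \<union> {a..Sup ?A}" using bdd cSup_upper[of _ ?A] by auto
      then have "emeasure lborel ?A \<le> emeasure lborel ((A \<inter> {..a}) \<union> {a..Sup ?A})"
        by (intro emeasure_mono) auto
      also have "\<dots> \<le> emeasure lborel (A \<inter> {..a}) + emeasure lborel {a..Sup ?A}"
        by (intro emeasure_subadditive) auto
      also have "\<dots> \<le> emeasure lborel (A \<inter> {..a}) + ennreal (e/2)"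
        using a cSup_upper[OF a(1) bdd(1)] by (intro add_left_mono) (simp add: ennreal_leI)
      finally have 1: "emeasure lborel ?A \<le> emeasure lborel (A \<inter> {..a}) + ennreal (e/2)" .
      have "?B \<subseteq> (B \<inter> {b..}) \<union> {Inf ?B..b}" using bdd cInf_lower[of _ ?B] by auto
      then have "emeasure lborel ?B \<le> emeasure lborel ((B \<inter> {b..}) \<union> {Inf ?B..b})"
        by (intro emeasure_mono) auto
      also have "\<dots> \<le> emeasure lborel (B \<inter> {b..}) + emeasure lborel {Inf ?B..b}"
        by (intro emeasure_subadditive) auto
      also have "\<dots> \<le> emeasure lborel (B \<inter> {b..}) + ennreal (e/2)"
        using b cInf_lower[OF b(1) bdd(2)] by (intro add_left_mono) (simp add: ennreal_leI)
      finally have 2: "emeasure lborel ?B \<le> emeasure lborel (B \<inter> {b..}) + ennreal (e/2)" .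
      have "emeasure lborel ?A + emeasure lborel ?B
          \<le> (emeasure lborel (A \<inter> {..a}) + emeasure lborel (B \<inter> {b..})) + (ennreal (e/2) + ennreal (e/2))"
        using add_mono[OF 1 2] by (simp add: ac_simps)
      also have "ennreal (e/2) + ennreal (e/2) = ennreal e"
        using e by (simp flip: ennreal_plus)
      also have "(emeasure lborel (A \<inter> {..a}) + emeasure lborel (B \<inter> {b..})) + ennreal e
          \<le> 2 * emeasure lborel C + ennreal e"
        using half[of a b] a b by (intro add_right_mono) auto
      finally show "emeasure lborel ?A + emeasure lborel ?B \<le> 2 * emeasure lborel C + ennreal e" .
    qed
  qed
  have lim: "(\<lambda>k. emeasure lborel (X \<inter> {-real k..real k})) \<longlonglongrightarrow> emeasure lborel X"
    if [measurable]: "X \<in> sets borel" for X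
  proof -
    have U: "(\<Union>k::nat. X \<inter> {-real k..real k}) = X"
    proof (intro equalityI subsetI)
      fix x assume "x \<in> X"
      obtain k :: nat where "\<bar>x\<bar> \<le> real k" using real_arch_simple by blast
      with \<open>x \<in> X\<close> show "x \<in> (\<Union>k::nat. X \<inter> {-real k..real k})" by (intro UN_I[of k]) auto
    qed auto
    have "(\<lambda>k. emeasure lborel (X \<inter> {-real k..real k})) \<longlonglongrightarrow> emeasure lborel (\<Union>k::nat. X \<inter> {-real k..real k})"
      by (intro Lim_emeasure_incseq) (auto simp: incseq_def)
    then show ?thesis unfolding U .
  qed
  obtain a0 b0 where ab0: "a0 \<in> A" "b0 \<in> B" using ne by blast
  obtain N :: nat where N: "\<bar>a0\<bar> + \<bar>b0\<bar> \<le> real N" using real_arch_simple by blast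
  have "emeasure lborel (A \<inter> {-real k..real k}) + emeasure lborel (B \<inter> {-real k..real k})
      \<le> 2 * emeasure lborel C" if "N \<le> k" for k
  proof (rule bounded)
    have "real N \<le> real k" using that by simp
    with N ab0 have "a0 \<in> A \<inter> {-real k..real k}" "b0 \<in> B \<inter> {-real k..real k}" by auto
    then show "A \<inter> {-real k..real k} \<noteq> {}" "B \<inter> {-real k..real k} \<noteq> {}" by blast+
  qed
  then show ?thesis
    by (intro LIMSEQ_le_const2[OF tendsto_add[OF lim[of A] lim[of B]]]) auto
qed

text \<open>
  A number \<open>f x\<close> is the length of the interval of all \<open>t \<ge> 0\<close> below it; Fubini does the rest.
\<close>

lemma nn_integral_layer_cake:
  fixes f :: "real \<Rightarrow> ennreal"
  assumes [measurable]: "f \<in> borel_measurable borel"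
  shows "(\<integral>\<^sup>+x. f x \<partial>lborel) = (\<integral>\<^sup>+t. emeasure lborel {x. ennreal t < f x} * indicator {0..} t \<partial>lborel)"
proof -
  have level: "f x = (\<integral>\<^sup>+t. indicator {x. ennreal t < f x} x * indicator {0..} t \<partial>lborel)" for x
  proof (cases "f x")
    case (real r)
    have "(\<integral>\<^sup>+t. indicator {x. ennreal t < f x} x * indicator {0..} t \<partial>lborel)
        = (\<integral>\<^sup>+t. indicator {0..<r} t \<partial>lborel)"
      using real by (intro nn_integral_cong) (auto simp: indicator_def ennreal_less_iff)
    then show ?thesis using real by simp
  next
    case top
    have "(\<integral>\<^sup>+t. indicator {x. ennreal t < f x} x * indicator {0..} t \<partial>lborel)
        = (\<integral>\<^sup>+t. indicator {0::real..} t \<partial>lborel)"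
      using top by (intro nn_integral_cong) (auto simp: indicator_def)
    moreover have "emeasure lborel {0::real..} = top"
    proof -
      have "ennreal (real k) \<le> emeasure lborel {0::real..}" for k
        using emeasure_mono[of "{0..real k}" "{0::real..}" lborel] by auto
      then show ?thesis
        by (metis ennreal_Ex_less_of_nat ennreal_of_nat_eq_real_of_nat leD top.not_eq_extremum)
    qed
    ultimately show ?thesis using top by simp
  qed
  have "(\<integral>\<^sup>+x. f x \<partial>lborel)
      = (\<integral>\<^sup>+x. (\<integral>\<^sup>+t. indicator {x. ennreal t < f x} x * indicator {0..} t \<partial>lborel) \<partial>lborel)"
    by (intro nn_integral_cong level)
  also have "\<dots> = (\<integral>\<^sup>+t. (\<integral>\<^sup>+x. indicator {x. ennreal t < f x} x * indicator {0..} t \<partial>lborel) \<partial>lborel)"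
    by (rule lborel_pair.Fubini') measurable
  also have "\<dots> = (\<integral>\<^sup>+t. emeasure lborel {x. ennreal t < f x} * indicator {0..} t \<partial>lborel)"
    by (intro nn_integral_cong) (simp add: nn_integral_multc)
  finally show ?thesis .
qed

text \<open>
  When both suprema equal 1, every level \<open>t < 1\<close> is exceeded by \<open>f\<close> as well as by \<open>g\<close>, so the
  superlevel sets are non-empty and the inequality for sets applies to them; at levels \<open>t \<ge> 1\<close> there
  is nothing to compare. Integration over \<open>t\<close> gives an additive inequality, which is stronger than the
  multiplicative one by the inequality of the means.
\<close>

lemma prekopa_leindler_normalized:
  fixes f g h :: "real \<Rightarrow> ennreal"
  assumes [measurable]: "f \<in> borel_measurable borel" "g \<in> borel_measurable borel" "h \<in> borel_measurable borel"
    and sup: "(SUP x. f x) = 1" "(SUP x. g x) = 1"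
    and le: "\<And>x y. min (f x) (g y) \<le> h ((x + y) / 2)"
  shows "(\<integral>\<^sup>+x. f x \<partial>lborel) + (\<integral>\<^sup>+x. g x \<partial>lborel) \<le> 2 * (\<integral>\<^sup>+x. h x \<partial>lborel)"
proof -
  have levels: "emeasure lborel {x. ennreal t < f x} + emeasure lborel {x. ennreal t < g x}
      \<le> 2 * emeasure lborel {x. ennreal t < h x}" if "0 \<le> t" for t :: real
  proof (cases "t < 1")
    case True
    then have "ennreal t < (SUP x. f x)" "ennreal t < (SUP x. g x)"
      using that by (simp_all add: sup)
    then have ne: "{x. ennreal t < f x} \<noteq> {}" "{x. ennreal t < g x} \<noteq> {}"
      unfolding less_SUP_iff by auto
    show ?thesis
    proof (rule emeasure_add_le_midpoints[OF _ _ _ _ ne])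
      fix a b assume "a \<in> {x. ennreal t < f x}" "b \<in> {x. ennreal t < g x}"
      then show "(a + b) / 2 \<in> {x. ennreal t < h x}"
        using less_le_trans[OF _ le[of a b], of "ennreal t"] by auto
    qed measurable
  next
    case False
    then have "1 \<le> ennreal t" by simp
    moreover have "f x \<le> 1" "g x \<le> 1" for x
      using sup SUP_upper[of x UNIV f] SUP_upper[of x UNIV g] by simp_all
    ultimately have "\<not> ennreal t < f x" "\<not> ennreal t < g x" for x
      by (meson leD order_trans)+
    then show ?thesis by simp
  qed
  have "(\<integral>\<^sup>+x. f x \<partial>lborel) + (\<integral>\<^sup>+x. g x \<partial>lborel)
      = (\<integral>\<^sup>+t. emeasure lborel {x. ennreal t < f x} * indicator {0..} t
          + emeasure lborel {x. ennreal t < g x} * indicator {0..} t \<partial>lborel)"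
    by (subst nn_integral_add) (simp_all flip: nn_integral_layer_cake)
  also have "\<dots> \<le> (\<integral>\<^sup>+t. 2 * (emeasure lborel {x. ennreal t < h x} * indicator {0..} t) \<partial>lborel)"
    using levels by (intro nn_integral_mono) (auto simp: indicator_def)
  also have "\<dots> = 2 * (\<integral>\<^sup>+x. h x \<partial>lborel)"
    by (subst nn_integral_cmult) (simp_all flip: nn_integral_layer_cake)
  finally show ?thesis .
qed

text \<open>
  Reduction to suprema 1: divide \<open>f\<close>, \<open>g\<close> and \<open>h\<close> by \<open>s\<close>, \<open>t\<close> and \<open>sqrt (s * t)\<close>, where \<open>s\<close> and
  \<open>t\<close> are the suprema of \<open>f\<close> and \<open>g\<close>. Boundedness makes these suprema finite.
\<close>

lemma prekopa_leindler_bounded: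
  fixes f g h :: "real \<Rightarrow> ennreal"
  assumes [measurable]: "f \<in> borel_measurable borel" "g \<in> borel_measurable borel" "h \<in> borel_measurable borel"
    and le: "\<And>x y. f x * g y \<le> (h ((x + y) / 2))\<^sup>2"
    and bound: "\<And>x. f x \<le> ennreal k" "\<And>x. g x \<le> ennreal k"
  shows "(\<integral>\<^sup>+x. f x \<partial>lborel) * (\<integral>\<^sup>+x. g x \<partial>lborel) \<le> (\<integral>\<^sup>+x. h x \<partial>lborel)\<^sup>2"
proof -
  define S T where "S = (SUP x. f x)" and "T = (SUP x. g x)"
  have up: "f x \<le> S" "g x \<le> T" for x
    by (simp_all add: S_def T_def SUP_upper)
  consider "S = 0" | "T = 0" | "S \<noteq> 0" "T \<noteq> 0" by blast
  then show ?thesis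
  proof cases
    case 1
    then have "f x = 0" for x using up(1)[of x] by simp
    then show ?thesis by simp
  next
    case 2
    then have "g x = 0" for x using up(2)[of x] by simp
    then show ?thesis by simp
  next
    case 3
    have "S \<le> ennreal k" "T \<le> ennreal k"
      using bound by (auto simp: S_def T_def intro!: SUP_least)
    then have fin: "S < top" "T < top" by (auto intro: le_less_trans)
    define s t where "s = enn2real S" and "t = enn2real T"
    have ST: "S = ennreal s" "T = ennreal t" and s: "0 < s" and t: "0 < t"
      using 3 fin by (auto simp: s_def t_def enn2real_positive_iff zero_less_iff_neq_zero)
    define w where "w = sqrt (s * t)"
    have w: "0 < w" "w\<^sup>2 = s * t" using s t by (simp_all add: w_def)
    have norm_le: "min (ennreal (1/s) * f x) (ennreal (1/t) * g y) \<le> ennreal (1/w) * h ((x + y) / 2)" for x y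
    proof (cases "h ((x + y) / 2)")
      case top
      then show ?thesis using w by (simp add: ennreal_mult_top)
    next
      case (real c)
      obtain a where a: "f x = ennreal a" "0 \<le> a"
        using up(1)[of x] fin by (cases "f x") (auto simp: top_unique)
      obtain b where b: "g y = ennreal b" "0 \<le> b"
        using up(2)[of y] fin by (cases "g y") (auto simp: top_unique)
      have "ennreal (a * b) \<le> ennreal (c\<^sup>2)"
        using le[of x y] a b real by (simp add: ennreal_mult ennreal_power)
      then have ab: "a * b \<le> c\<^sup>2" by (simp add: ennreal_le_iff)
      have "min (a/s) (b/t) \<le> c/w"
      proof (rule power2_le_imp_le)
        have "(min (a/s) (b/t))\<^sup>2 \<le> (a/s) * (b/t)"
          unfolding power2_eq_square using a b s t by (intro mult_mono) auto
        also have "\<dots> = (a * b) / w\<^sup>2" using w by simp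
        also have "\<dots> \<le> c\<^sup>2 / w\<^sup>2" using ab by (intro divide_right_mono) auto
        finally show "(min (a/s) (b/t))\<^sup>2 \<le> (c/w)\<^sup>2" by (simp add: power_divide)
        show "0 \<le> c/w" using real w by simp
      qed
      then have "ennreal (min (a/s) (b/t)) \<le> ennreal (c/w)" by (rule ennreal_leI)
      moreover have "ennreal (min (a/s) (b/t)) = min (ennreal (a/s)) (ennreal (b/t))"
        using a b s t by (simp add: min_def ennreal_le_iff)
      ultimately show ?thesis using a b real s t w by (simp flip: ennreal_mult)
    qed
    have "(\<integral>\<^sup>+x. ennreal (1/s) * f x \<partial>lborel) + (\<integral>\<^sup>+x. ennreal (1/t) * g x \<partial>lborel)
        \<le> 2 * (\<integral>\<^sup>+x. ennreal (1/w) * h x \<partial>lborel)"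
    proof (rule prekopa_leindler_normalized)
      show "min (ennreal (1/s) * f x) (ennreal (1/t) * g y) \<le> ennreal (1/w) * h ((x + y) / 2)" for x y
        by (rule norm_le)
      show "(SUP x. ennreal (1/s) * f x) = 1"
        using s ST(1) by (simp flip: SUP_mult_left_ennreal S_def ennreal_mult)
      show "(SUP x. ennreal (1/t) * g x) = 1"
        using t ST(2) by (simp flip: SUP_mult_left_ennreal T_def ennreal_mult)
    qed measurable
    then have sum_le: "ennreal (1/s) * (\<integral>\<^sup>+x. f x \<partial>lborel) + ennreal (1/t) * (\<integral>\<^sup>+x. g x \<partial>lborel)
        \<le> 2 * (ennreal (1/w) * (\<integral>\<^sup>+x. h x \<partial>lborel))"
      by (simp add: nn_integral_cmult)
    show ?thesis
    proof (cases "\<integral>\<^sup>+x. h x \<partial>lborel")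
      case top
      then show ?thesis by (simp add: power2_eq_square)
    next
      case (real c)
      then have fin: "2 * (ennreal (1/w) * (\<integral>\<^sup>+x. h x \<partial>lborel)) < top"
        using ennreal_mult_less_top by auto
      have "(\<integral>\<^sup>+x. f x \<partial>lborel) \<noteq> top"
        using sum_le fin s by (auto simp: ennreal_mult_top top_unique)
      then obtain a where a: "(\<integral>\<^sup>+x. f x \<partial>lborel) = ennreal a" "0 \<le> a"
        by (metis ennreal_cases)
      have "(\<integral>\<^sup>+x. g x \<partial>lborel) \<noteq> top"
        using sum_le fin t by (auto simp: ennreal_mult_top top_unique)
      then obtain b where b: "(\<integral>\<^sup>+x. g x \<partial>lborel) = ennreal b" "0 \<le> b"
        by (metis ennreal_cases)
      have eq: "2 * ennreal (c/w) = ennreal (2 * (c/w))"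
        using real w by (subst ennreal_mult) auto
      have "ennreal (a/s + b/t) \<le> ennreal (2 * (c/w))"
        unfolding eq[symmetric]
        using sum_le a b real s t w by (simp flip: ennreal_mult ennreal_plus)
      then have "a/s + b/t \<le> 2 * (c/w)"
        using real w by (simp add: ennreal_le_iff)
      then have "(a/s + b/t)\<^sup>2 \<le> (2 * (c/w))\<^sup>2"
        using a b s t by (intro power_mono) auto
      moreover have "4 * ((a/s) * (b/t)) \<le> (a/s + b/t)\<^sup>2"
        using zero_le_power2[of "a/s - b/t"] by (simp add: power2_sum power2_diff)
      ultimately have "(a * b) / (s * t) \<le> c\<^sup>2 / (s * t)"
        by (simp add: power_mult_distrib power_divide w)
      then have "a * b \<le> c\<^sup>2" using s t by (simp add: divide_le_cancel zero_less_mult_iff)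
      then have "ennreal (a * b) \<le> ennreal (c\<^sup>2)" by (rule ennreal_leI)
      then show ?thesis using a b real by (simp add: ennreal_mult ennreal_power)
    qed
  qed
qed

text \<open>
  Truncating \<open>f\<close> and \<open>g\<close> at height \<open>k\<close> preserves the hypothesis, and monotone convergence recovers the
  full integrals as \<open>k\<close> grows.
\<close>

lemma prekopa_leindler_midpoint_real:
  fixes f g h :: "real \<Rightarrow> ennreal"
  assumes [measurable]: "f \<in> borel_measurable borel" "g \<in> borel_measurable borel" "h \<in> borel_measurable borel"
    and le: "\<And>x y. f x * g y \<le> (h ((x + y) / 2))\<^sup>2"
  shows "(\<integral>\<^sup>+x. f x \<partial>lborel) * (\<integral>\<^sup>+x. g x \<partial>lborel) \<le> (\<integral>\<^sup>+x. h x \<partial>lborel)\<^sup>2"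
proof -
  define F where "F p k = (\<integral>\<^sup>+x. min (p x) (ennreal (real k)) \<partial>lborel)" for p :: "real \<Rightarrow> ennreal" and k :: nat
  have mono: "F p i \<le> F p j" if "i \<le> j" for p i j
    unfolding F_def using that by (intro nn_integral_mono min.mono order_refl ennreal_leI) simp
  have lim: "(\<integral>\<^sup>+x. p x \<partial>lborel) = (SUP k. F p k)" if [measurable]: "p \<in> borel_measurable borel" for p
  proof -
    have "p x = (SUP k. min (p x) (ennreal (real k)))" for x
    proof (rule antisym)
      show "p x \<le> (SUP k. min (p x) (ennreal (real k)))"
      proof (rule le_SUP_iff[THEN iffD2], intro allI impI)
        fix y assume y: "y < p x"
        then have "y < top" by (rule less_le_trans) simp
        then obtain k where "y < of_nat k" using ennreal_Ex_less_of_nat[of y] by auto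
        with y show "\<exists>k\<in>UNIV. y < min (p x) (ennreal (real k))"
          by (auto simp: ennreal_of_nat_eq_real_of_nat)
      qed
    qed (simp add: SUP_least)
    then have "(\<integral>\<^sup>+x. p x \<partial>lborel) = (\<integral>\<^sup>+x. (SUP k. min (p x) (ennreal (real k))) \<partial>lborel)"
      by simp
    also have "\<dots> = (SUP k. F p k)"
      unfolding F_def
      by (intro nn_integral_monotone_convergence_SUP incseq_SucI le_funI min.mono order_refl ennreal_leI)
        auto
    finally show ?thesis .
  qed
  have "F f i * F g j \<le> (\<integral>\<^sup>+x. h x \<partial>lborel)\<^sup>2" for i j
  proof -
    have "F f i * F g j \<le> F f (max i j) * F g (max i j)"
      by (intro mult_mono mono) auto
    also have "\<dots> \<le> (\<integral>\<^sup>+x. h x \<partial>lborel)\<^sup>2"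
      unfolding F_def
    proof (rule prekopa_leindler_bounded[where k = "real (max i j)"])
      fix x y show "min (f x) (ennreal (max i j)) * min (g y) (ennreal (max i j)) \<le> (h ((x + y) / 2))\<^sup>2"
        by (rule order_trans[OF mult_mono le]) auto
    qed auto
    finally show ?thesis .
  qed
  then show ?thesis
    by (simp add: lim SUP_mult_left_ennreal SUP_mult_right_ennreal SUP_least)
qed

text \<open>
  The hypothesis and the conclusion have the same shape, hence the inequality tensorizes: for fixed last
  coordinates \<open>s\<close>, \<open>t\<close> and \<open>(s + t) / 2\<close> the induction hypothesis applied to the slices says that the
  slice integrals satisfy the hypothesis of the one-dimensional inequality. Taking the square of \<open>h\<close>
  on the right avoids roots of extended reals.
\<close>

theorem prekopa_leindler_midpoint:
  fixes f g h :: "('i \<Rightarrow> real) \<Rightarrow> ennreal"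
  assumes "finite I"
    and "f \<in> borel_measurable (\<Pi>\<^sub>M i\<in>I. lborel)"
      "g \<in> borel_measurable (\<Pi>\<^sub>M i\<in>I. lborel)" "h \<in> borel_measurable (\<Pi>\<^sub>M i\<in>I. lborel)"
    and "\<And>x y. x \<in> I \<rightarrow>\<^sub>E UNIV \<Longrightarrow> y \<in> I \<rightarrow>\<^sub>E UNIV \<Longrightarrow> f x * g y \<le> (h (\<lambda>i\<in>I. (x i + y i) / 2))\<^sup>2"
  shows "(\<integral>\<^sup>+x. f x \<partial>(\<Pi>\<^sub>M i\<in>I. lborel)) * (\<integral>\<^sup>+x. g x \<partial>(\<Pi>\<^sub>M i\<in>I. lborel))
    \<le> (\<integral>\<^sup>+x. h x \<partial>(\<Pi>\<^sub>M i\<in>I. lborel))\<^sup>2"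
  using assms
proof (induction I arbitrary: f g h rule: finite_induct)
  case empty
  interpret product_sigma_finite "\<lambda>_ :: 'i. lborel :: real measure" by standard
  have "f (\<lambda>_. undefined) * g (\<lambda>_. undefined) \<le> (h (\<lambda>_. undefined))\<^sup>2"
    using empty.prems(4)[of "\<lambda>_. undefined" "\<lambda>_. undefined"] by (simp add: restrict_def)
  then show ?case by (simp add: PiM_empty nn_integral_count_space_finite)
next
  case (insert i I)
  interpret product_sigma_finite "\<lambda>_ :: 'i. lborel :: real measure" by standard
  interpret finite_product_sigma_finite "\<lambda>_ :: 'i. lborel :: real measure" I by standard fact
  note [measurable] = insert.prems(1-3)
  have m: "(\<lambda>x. p (x(i := s))) \<in> borel_measurable (\<Pi>\<^sub>M i\<in>I. lborel)"
    if "p \<in> borel_measurable (\<Pi>\<^sub>M i\<in>insert i I. lborel)" for p :: "('i \<Rightarrow> real) \<Rightarrow> ennreal" and s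
    by (rule measurable_compose[OF measurable_fun_upd that]) auto
  have slice: "(\<integral>\<^sup>+x. f (x(i := s)) \<partial>(\<Pi>\<^sub>M i\<in>I. lborel)) * (\<integral>\<^sup>+x. g (x(i := t)) \<partial>(\<Pi>\<^sub>M i\<in>I. lborel))
      \<le> (\<integral>\<^sup>+x. h (x(i := (s + t) / 2)) \<partial>(\<Pi>\<^sub>M i\<in>I. lborel))\<^sup>2" for s t :: real
  proof (rule insert.IH)
    fix x y :: "'i \<Rightarrow> real" assume xy: "x \<in> I \<rightarrow>\<^sub>E UNIV" "y \<in> I \<rightarrow>\<^sub>E UNIV"
    then have up: "x(i := s) \<in> insert i I \<rightarrow>\<^sub>E UNIV" "y(i := t) \<in> insert i I \<rightarrow>\<^sub>E UNIV"
      by (auto simp: PiE_iff extensional_def)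
    have "(\<lambda>j\<in>insert i I. ((x(i := s)) j + (y(i := t)) j) / 2)
        = (\<lambda>j\<in>I. (x j + y j) / 2)(i := (s + t) / 2)"
      using insert.hyps by (auto simp: fun_eq_iff)
    from insert.prems(4)[OF up, unfolded this]
    show "f (x(i := s)) * g (y(i := t)) \<le> (h ((\<lambda>j\<in>I. (x j + y j) / 2)(i := (s + t) / 2)))\<^sup>2" .
  qed (intro m insert.prems)+
  have slices_measurable: "(\<lambda>s. \<integral>\<^sup>+x. p (x(i := s)) \<partial>(\<Pi>\<^sub>M i\<in>I. lborel)) \<in> borel_measurable borel"
    if [measurable]: "p \<in> borel_measurable (\<Pi>\<^sub>M i\<in>insert i I. lborel)" for p :: "('i \<Rightarrow> real) \<Rightarrow> ennreal"
  proof -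
    have "(\<lambda>s. \<integral>\<^sup>+x. p (x(i := s)) \<partial>(\<Pi>\<^sub>M i\<in>I. lborel)) \<in> borel_measurable (lborel :: real measure)"
      by measurable
    then show ?thesis by simp
  qed
  show ?case
    unfolding insert.prems(1-3)[THEN product_nn_integral_insert_rev[OF insert.hyps]]
    by (rule prekopa_leindler_midpoint_real[OF insert.prems(1-3)[THEN slices_measurable] slice])
qed

section \<open>Lebesgue measure on coordinate space\<close>

lemma space_lebesgue_n: "space (lebesgue_n n) = {..<n} \<rightarrow>\<^sub>E UNIV"
  by (simp add: lebesgue_n_def space_PiM)

lemma sigma_finite_lebesgue_n: "sigma_finite_measure (lebesgue_n n)"
proof -
  interpret finite_product_sigma_finite "\<lambda>_ :: nat. lborel :: real measure" "{..<n}" by standard simp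
  show ?thesis unfolding lebesgue_n_def by (rule sigma_finite_measure_axioms)
qed

lemma measurable_coordinate_n:
  "f \<in> measurable M (lebesgue_n n) \<Longrightarrow> i < n \<Longrightarrow> (\<lambda>w. f w i) \<in> borel_measurable M"
  using measurable_compose[of f M "lebesgue_n n" "\<lambda>x. x i" borel]
    measurable_component_singleton[of i "{..<n}" "\<lambda>_. lborel :: real measure"]
  by (simp add: lebesgue_n_def)

lemma measurable_inner_n [measurable]:
  assumes "f \<in> measurable M (lebesgue_n n)" "g \<in> measurable M (lebesgue_n n)"
  shows "(\<lambda>w. inner_n n (f w) (g w)) \<in> borel_measurable M"
  unfolding inner_n_def using assms[THEN measurable_coordinate_n] by measurable

lemma measurable_norm_n [measurable]:
  assumes "f \<in> measurable M (lebesgue_n n)"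
  shows "(\<lambda>w. norm_n n (f w)) \<in> borel_measurable M"
  unfolding L2_set_def using assms[THEN measurable_coordinate_n] by measurable

lemma measurable_restrict_n:
  assumes "\<And>i. i < n \<Longrightarrow> (\<lambda>w. f w i) \<in> borel_measurable M"
  shows "(\<lambda>w. \<lambda>i\<in>{..<n}. f w i) \<in> measurable M (lebesgue_n n)"
  unfolding lebesgue_n_def using assms by (intro measurable_restrict) auto

lemma inner_n_self: "inner_n n x x = (norm_n n x)\<^sup>2"
  by (simp add: inner_n_def L2_set_def sum_nonneg power2_eq_square)

lemma inner_n_commute: "inner_n n x y = inner_n n y x"
  by (simp add: inner_n_def mult.commute)

text \<open>
  Linear combinations are restricted to the index set so that they are again points of the carrier.
\<close>

lemma inner_n_combination:
  "inner_n n x (\<lambda>i\<in>{..<n}. a * y i + b * z i) = a * inner_n n x y + b * inner_n n x z"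
  by (simp add: inner_n_def sum_distrib_left distrib_left flip: sum.distrib) (simp add: ac_simps)

lemma norm_n_combination:
  "(norm_n n (\<lambda>i\<in>{..<n}. a * y i + b * z i))\<^sup>2
    = a\<^sup>2 * (norm_n n y)\<^sup>2 + 2 * a * b * inner_n n y z + b\<^sup>2 * (norm_n n z)\<^sup>2"
proof -
  define w where "w = (\<lambda>i\<in>{..<n}. a * y i + b * z i)"
  have "(norm_n n w)\<^sup>2 = a * inner_n n w y + b * inner_n n w z"
    by (simp flip: inner_n_self add: w_def inner_n_combination)
  also have "inner_n n w y = a * inner_n n y y + b * inner_n n y z"
    by (subst inner_n_commute) (simp add: w_def inner_n_combination inner_n_commute)
  also have "inner_n n w z = a * inner_n n z y + b * inner_n n z z"
    by (subst inner_n_commute) (simp add: w_def inner_n_combination inner_n_commute)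
  finally show ?thesis
    unfolding w_def[symmetric]
    by (simp add: inner_n_commute[of n z y] inner_n_self algebra_simps power2_eq_square)
qed

lemma norm_n_eq_0_imp_inner_n: "norm_n n y = 0 \<Longrightarrow> inner_n n x y = 0"
  by (simp add: inner_n_def L2_set_eq_0_iff)

lemma inner_n_scale: "inner_n n x (\<lambda>i\<in>{..<n}. y i / c) = inner_n n x y / c"
  by (simp add: inner_n_def sum_divide_distrib)

lemma norm_n_normalized:
  assumes "norm_n n y \<noteq> 0"
  shows "norm_n n (\<lambda>i\<in>{..<n}. y i / norm_n n y) = 1"
proof -
  have "(norm_n n (\<lambda>i\<in>{..<n}. y i / norm_n n y))\<^sup>2 = 1"
    using assms unfolding inner_n_self[symmetric] inner_n_scale
    by (subst inner_n_commute) (simp add: inner_n_scale inner_n_self power2_eq_square)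
  then show ?thesis using L2_set_nonneg[of "\<lambda>i\<in>{..<n}. y i / norm_n n y" "{..<n}"]
    by (simp add: power2_eq_1_iff)
qed

lemma unit_sphere_normalized:
  "norm_n n y \<noteq> 0 \<Longrightarrow> (\<lambda>i\<in>{..<n}. y i / norm_n n y) \<in> unit_sphere n"
  by (simp add: unit_sphere_def norm_n_normalized)

text \<open>
  The Prekopa--Leindler inequality for indicator functions.
\<close>

theorem brunn_minkowski_midpoint:
  assumes [measurable]: "A \<in> sets (lebesgue_n n)" "B \<in> sets (lebesgue_n n)" "C \<in> sets (lebesgue_n n)"
    and mid: "\<And>x y. x \<in> A \<Longrightarrow> y \<in> B \<Longrightarrow> (\<lambda>i\<in>{..<n}. (x i + y i) / 2) \<in> C"
  shows "emeasure (lebesgue_n n) A * emeasure (lebesgue_n n) B \<le> (emeasure (lebesgue_n n) C)\<^sup>2"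
proof -
  have "(\<integral>\<^sup>+x. indicator A x \<partial>lebesgue_n n) * (\<integral>\<^sup>+x. indicator B x \<partial>lebesgue_n n)
      \<le> (\<integral>\<^sup>+x. indicator C x \<partial>lebesgue_n n)\<^sup>2"
    unfolding lebesgue_n_def
  proof (rule prekopa_leindler_midpoint)
    show "indicator A x * indicator B y \<le> (indicator C (\<lambda>i\<in>{..<n}. (x i + y i) / 2) :: ennreal)\<^sup>2" for x y
      using mid[of x y] by (auto simp: indicator_def)
  qed (use assms in \<open>simp_all add: lebesgue_n_def\<close>)
  then show ?thesis by simp
qed

text \<open>
  The image of the product measure under the inverse homothety, rescaled, gives boxes their right
  measure because each coordinate is an affine substitution; boxes determine the product measure.
\<close>

lemma emeasure_homothety:
  assumes [measurable]: "A \<in> sets (lebesgue_n n)" and \<rho>: "0 < \<rho>"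
  shows "emeasure (lebesgue_n n) A
    = ennreal (\<rho> ^ n) * emeasure (lebesgue_n n) {x \<in> space (lebesgue_n n). (\<lambda>i\<in>{..<n}. v i + \<rho> * x i) \<in> A}"
proof -
  interpret product_sigma_finite "\<lambda>_ :: nat. lborel :: real measure" by standard
  let ?T = "\<lambda>x. \<lambda>i\<in>{..<n}. v i + \<rho> * x i"
  let ?P = "density (distr (lebesgue_n n) (lebesgue_n n) ?T) (\<lambda>_. ennreal (\<rho> ^ n))"
  have T[measurable]: "?T \<in> measurable (lebesgue_n n) (lebesgue_n n)"
    by (intro measurable_restrict_n borel_measurable_add borel_measurable_times measurable_coordinate_n[of "\<lambda>x. x"]) auto
  have P: "emeasure ?P A = ennreal (\<rho> ^ n) * emeasure (lebesgue_n n) (?T -` A \<inter> space (lebesgue_n n))"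
    if [measurable]: "A \<in> sets (lebesgue_n n)" for A
    by (simp add: emeasure_density nn_integral_cmult emeasure_distr)
  have P_eq: "?P = lebesgue_n n"
    unfolding lebesgue_n_def
  proof (rule PiM_eqI)
    fix A :: "nat \<Rightarrow> real set" assume A: "\<And>i. i \<in> {..<n} \<Longrightarrow> A i \<in> sets lborel"
    let ?B = "\<lambda>i. {x. v i + \<rho> * x \<in> A i}"
    have B: "?B i \<in> sets lborel" if "i < n" for i
    proof -
      have "(\<lambda>x. v i + \<rho> * x) -` A i \<inter> space borel \<in> sets borel"
        using A that by (intro measurable_sets[of _ borel borel]) auto
      then show ?thesis by (simp add: vimage_def)
    qed
    have "emeasure lborel (A i) = ennreal \<rho> * emeasure lborel (?B i)" if "i < n" for i
    proof -
      have "emeasure lborel (A i) = ennreal \<rho> * (\<integral>\<^sup>+x. indicator (A i) (v i + \<rho> * x) \<partial>lborel)"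
        using nn_integral_real_affine[of "indicator (A i)" \<rho> "v i"] A that \<rho> by simp
      also have "(\<integral>\<^sup>+x. indicator (A i) (v i + \<rho> * x) \<partial>lborel) = (\<integral>\<^sup>+x. indicator (?B i) x \<partial>lborel)"
        by (intro nn_integral_cong) (simp add: indicator_def)
      finally show ?thesis using B[OF that] by simp
    qed
    then have prod: "(\<Prod>i<n. emeasure lborel (A i)) = ennreal (\<rho> ^ n) * (\<Prod>i<n. emeasure lborel (?B i))"
      using \<rho> by (simp add: prod.distrib ennreal_power)
    have AP: "Pi\<^sub>E {..<n} A \<in> sets (lebesgue_n n)"
      unfolding lebesgue_n_def using A by (intro sets_PiM_I_finite) auto
    have "?T -` Pi\<^sub>E {..<n} A \<inter> space (lebesgue_n n) = Pi\<^sub>E {..<n} ?B"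
      by (rule set_eqI) (simp add: space_lebesgue_n PiE_iff conj_commute)
    then have "emeasure ?P (Pi\<^sub>E {..<n} A) = ennreal (\<rho> ^ n) * emeasure (lebesgue_n n) (Pi\<^sub>E {..<n} ?B)"
      by (simp add: P[OF AP])
    also have "emeasure (lebesgue_n n) (Pi\<^sub>E {..<n} ?B) = (\<Prod>i<n. emeasure lborel (?B i))"
      unfolding lebesgue_n_def using B by (subst emeasure_PiM) auto
    finally show "emeasure (density (distr (\<Pi>\<^sub>M i\<in>{..<n}. lborel) (\<Pi>\<^sub>M i\<in>{..<n}. lborel) ?T) (\<lambda>_. ennreal (\<rho> ^ n)))
        (Pi\<^sub>E {..<n} A) = (\<Prod>i<n. emeasure lborel (A i))"
      using prod unfolding lebesgue_n_def by (simp only:)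
  qed simp_all
  have "emeasure (lebesgue_n n) A = emeasure ?P A" by (simp only: P_eq)
  also have "\<dots> = ennreal (\<rho> ^ n) * emeasure (lebesgue_n n) (?T -` A \<inter> space (lebesgue_n n))"
    by (rule P) measurable
  also have "?T -` A \<inter> space (lebesgue_n n) = {x \<in> space (lebesgue_n n). ?T x \<in> A}"
    by auto
  finally show ?thesis .
qed

lemma emeasure_homothety_le:
  assumes [measurable]: "S \<in> sets (lebesgue_n n)" "A \<in> sets (lebesgue_n n)" and \<rho>: "0 < \<rho>"
    and sub: "\<And>y. y \<in> S \<Longrightarrow> (\<lambda>i\<in>{..<n}. v i + \<rho> * y i) \<in> A"
  shows "ennreal (\<rho> ^ n) * emeasure (lebesgue_n n) S \<le> emeasure (lebesgue_n n) A"
  unfolding emeasure_homothety[OF assms(2) \<rho>, of v]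
proof (intro mult_left_mono emeasure_mono)
  show "S \<subseteq> {x \<in> space (lebesgue_n n). (\<lambda>i\<in>{..<n}. v i + \<rho> * x i) \<in> A}"
    using sub sets.sets_into_space[OF assms(1)] by auto
  have [measurable]: "(\<lambda>x. \<lambda>i\<in>{..<n}. v i + \<rho> * x i) \<in> measurable (lebesgue_n n) (lebesgue_n n)"
    by (intro measurable_restrict_n borel_measurable_add borel_measurable_times measurable_coordinate_n[of "\<lambda>x. x"]) auto
  show "{x \<in> space (lebesgue_n n). (\<lambda>i\<in>{..<n}. v i + \<rho> * x i) \<in> A} \<in> sets (lebesgue_n n)"
    by measurable
qed simp

text \<open>
  Fubini for a subset of \<open>K \<times> B\<close>: its measure can be computed by slicing in either direction.
\<close>

lemma nn_integral_sections_swap: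
  assumes [measurable]: "K \<in> sets (lebesgue_n n)" "B \<in> sets (lebesgue_n n)"
    and [measurable]: "Measurable.pred (lebesgue_n n \<Otimes>\<^sub>M lebesgue_n n) (\<lambda>(x, y). P x y)"
  shows "(\<integral>\<^sup>+x\<in>K. emeasure (lebesgue_n n) {y \<in> B. P x y} \<partial>lebesgue_n n)
    = (\<integral>\<^sup>+y\<in>B. emeasure (lebesgue_n n) {x \<in> K. P x y} \<partial>lebesgue_n n)"
proof -
  interpret pair_sigma_finite "lebesgue_n n" "lebesgue_n n"
    by (intro pair_sigma_finite.intro sigma_finite_lebesgue_n)
  define Q where "Q = {w \<in> space (lebesgue_n n \<Otimes>\<^sub>M lebesgue_n n). P (fst w) (snd w) \<and> fst w \<in> K \<and> snd w \<in> B}"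
  have "(\<lambda>w. P (fst w) (snd w)) = (\<lambda>(x, y). P x y)" by auto
  then have [measurable]: "Measurable.pred (lebesgue_n n \<Otimes>\<^sub>M lebesgue_n n) (\<lambda>w. P (fst w) (snd w))"
    using assms(3) by simp
  have Q[measurable]: "Q \<in> sets (lebesgue_n n \<Otimes>\<^sub>M lebesgue_n n)"
    unfolding Q_def by measurable
  have KB: "K \<subseteq> space (lebesgue_n n)" "B \<subseteq> space (lebesgue_n n)"
    using assms(1,2)[THEN sets.sets_into_space] by auto
  have 1: "emeasure (lebesgue_n n) {y \<in> B. P x y} * indicator K x = (\<integral>\<^sup>+y. indicator Q (x, y) \<partial>lebesgue_n n)"
    if x: "x \<in> space (lebesgue_n n)" for x
  proof -
    have eq: "{y \<in> space (lebesgue_n n). (x, y) \<in> Q} = (if x \<in> K then {y \<in> B. P x y} else {})"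
      using KB by (auto simp: Q_def space_pair_measure)
    have "(\<integral>\<^sup>+y. indicator Q (x, y) \<partial>lebesgue_n n)
        = (\<integral>\<^sup>+y. indicator {y \<in> space (lebesgue_n n). (x, y) \<in> Q} y \<partial>lebesgue_n n)"
      by (intro nn_integral_cong) (auto simp: indicator_def)
    also have "\<dots> = emeasure (lebesgue_n n) {y \<in> space (lebesgue_n n). (x, y) \<in> Q}"
      using x by (intro nn_integral_indicator) measurable
    finally show ?thesis unfolding eq by auto
  qed
  have 2: "emeasure (lebesgue_n n) {x \<in> K. P x y} * indicator B y = (\<integral>\<^sup>+x. indicator Q (x, y) \<partial>lebesgue_n n)"
    if y: "y \<in> space (lebesgue_n n)" for y
  proof -
    have eq: "{x \<in> space (lebesgue_n n). (x, y) \<in> Q} = (if y \<in> B then {x \<in> K. P x y} else {})"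
      using KB by (auto simp: Q_def space_pair_measure)
    have "(\<integral>\<^sup>+x. indicator Q (x, y) \<partial>lebesgue_n n)
        = (\<integral>\<^sup>+x. indicator {x \<in> space (lebesgue_n n). (x, y) \<in> Q} x \<partial>lebesgue_n n)"
      by (intro nn_integral_cong) (auto simp: indicator_def)
    also have "\<dots> = emeasure (lebesgue_n n) {x \<in> space (lebesgue_n n). (x, y) \<in> Q}"
      using y by (intro nn_integral_indicator) measurable
    finally show ?thesis unfolding eq by auto
  qed
  have "(\<integral>\<^sup>+x. (\<integral>\<^sup>+y. indicator Q (x, y) \<partial>lebesgue_n n) \<partial>lebesgue_n n)
      = (\<integral>\<^sup>+y. (\<integral>\<^sup>+x. indicator Q (x, y) \<partial>lebesgue_n n) \<partial>lebesgue_n n)"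
    by (rule Fubini'[symmetric]) measurable
  then show ?thesis
    using 1 2 by (simp cong: nn_integral_cong)
qed

section \<open>Mass of an isotropic body far from the origin\<close>

locale isotropic_body =
  fixes n :: nat and K :: "(nat \<Rightarrow> real) set" and L :: real
  assumes dim: "n \<ge> 1"
    and K_sets [measurable]: "K \<in> sets (lebesgue_n n)"
    and volume: "emeasure (lebesgue_n n) K = 1"
    and convex: "convex_n n K"
    and second_moments: "is_isotropic_constant n K L"
begin

lemma L_pos: "0 < L"
  using second_moments by (simp add: is_isotropic_constant_def)

lemma K_subset_space: "K \<subseteq> space (lebesgue_n n)"
  by (rule sets.sets_into_space) (rule K_sets)

lemma emeasure_part_finite: "emeasure (lebesgue_n n) {x \<in> K. P x} < top"
proof (cases "{x \<in> K. P x} \<in> sets (lebesgue_n n)")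
  case True
  have "emeasure (lebesgue_n n) {x \<in> K. P x} \<le> emeasure (lebesgue_n n) K"
    by (intro emeasure_mono) auto
  then show ?thesis using volume by (auto intro: le_less_trans)
qed (simp add: emeasure_notin_sets)

lemma emeasure_part: "emeasure (lebesgue_n n) {x \<in> K. P x} = ennreal (measure (lebesgue_n n) {x \<in> K. P x})"
  using emeasure_part_finite[of P] by (simp add: emeasure_eq_ennreal_measure less_top)

lemma sets_part [measurable (raw)]:
  "Measurable.pred (lebesgue_n n) P \<Longrightarrow> {x \<in> K. P x} \<in> sets (lebesgue_n n)"
proof -
  assume [measurable]: "Measurable.pred (lebesgue_n n) P"
  have "{x \<in> K. P x} = K \<inter> {x \<in> space (lebesgue_n n). P x}" using K_subset_space by auto
  then show ?thesis by simp
qed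

lemma measure_part_add:
  assumes "Measurable.pred (lebesgue_n n) P"
  shows "measure (lebesgue_n n) {x \<in> K. P x} + measure (lebesgue_n n) {x \<in> K. \<not> P x} = 1"
proof -
  have m: "{x \<in> K. P x} \<in> sets (lebesgue_n n)" "{x \<in> K. \<not> P x} \<in> sets (lebesgue_n n)"
    using assms by (auto intro!: sets_part)
  have "ennreal (measure (lebesgue_n n) {x \<in> K. P x} + measure (lebesgue_n n) {x \<in> K. \<not> P x})
      = emeasure (lebesgue_n n) {x \<in> K. P x} + emeasure (lebesgue_n n) {x \<in> K. \<not> P x}"
    by (simp add: emeasure_part)
  also have "\<dots> = emeasure (lebesgue_n n) ({x \<in> K. P x} \<union> {x \<in> K. \<not> P x})"
    using m by (intro plus_emeasure) auto
  also have "{x \<in> K. P x} \<union> {x \<in> K. \<not> P x} = K" by auto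
  finally have "ennreal (measure (lebesgue_n n) {x \<in> K. P x} + measure (lebesgue_n n) {x \<in> K. \<not> P x}) = ennreal 1"
    by (simp only: volume ennreal_1)
  then show ?thesis by (subst (asm) ennreal_inj) auto
qed

lemma measurable_inner [measurable]: "y \<in> space (lebesgue_n n) \<Longrightarrow> (\<lambda>x. inner_n n x y) \<in> borel_measurable (lebesgue_n n)"
  by (intro measurable_inner_n) auto

lemma second_moment_unit:
  assumes "\<theta> \<in> unit_sphere n"
  shows "(\<integral>\<^sup>+x\<in>K. ennreal ((inner_n n x \<theta>)\<^sup>2) \<partial>lebesgue_n n) = ennreal (L\<^sup>2)"
proof -
  let ?f = "\<lambda>x. indicator K x * (inner_n n x \<theta>)\<^sup>2"
  have int: "(\<integral>x. ?f x \<partial>lebesgue_n n) = L\<^sup>2"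
    using second_moments assms by (simp add: is_isotropic_constant_def set_lebesgue_integral_def)
  then have "integrable (lebesgue_n n) ?f"
    using not_integrable_integral_eq[of "lebesgue_n n" ?f] L_pos by fastforce
  then have "(\<integral>\<^sup>+x. ennreal (?f x) \<partial>lebesgue_n n) = ennreal (L\<^sup>2)"
    using int by (subst nn_integral_eq_integral) auto
  moreover have "ennreal (?f x) = ennreal ((inner_n n x \<theta>)\<^sup>2) * indicator K x" for x
    by (simp add: indicator_def)
  ultimately show ?thesis by simp
qed

lemma second_moment:
  assumes y: "y \<in> space (lebesgue_n n)"
  shows "(\<integral>\<^sup>+x\<in>K. ennreal ((inner_n n x y)\<^sup>2) \<partial>lebesgue_n n) = ennreal (L\<^sup>2 * (norm_n n y)\<^sup>2)"
proof (cases "norm_n n y = 0")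
  case True
  then show ?thesis by (simp add: norm_n_eq_0_imp_inner_n)
next
  case False
  define r where "r = norm_n n y"
  define \<theta> where "\<theta> = (\<lambda>i\<in>{..<n}. y i / norm_n n y)"
  have \<theta>: "\<theta> \<in> unit_sphere n" "\<theta> \<in> space (lebesgue_n n)"
    using unit_sphere_normalized[OF False] by (auto simp: \<theta>_def space_lebesgue_n)
  have y_eq: "inner_n n x y = r * inner_n n x \<theta>" for x
    using False unfolding \<theta>_def inner_n_scale r_def by simp
  have "(\<integral>\<^sup>+x\<in>K. ennreal ((inner_n n x y)\<^sup>2) \<partial>lebesgue_n n)
      = (\<integral>\<^sup>+x. ennreal (r\<^sup>2) * (ennreal ((inner_n n x \<theta>)\<^sup>2) * indicator K x) \<partial>lebesgue_n n)"
    by (intro nn_integral_cong) (simp add: y_eq power_mult_distrib ennreal_mult mult.assoc)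
  also have "\<dots> = ennreal (r\<^sup>2) * ennreal (L\<^sup>2)"
    using \<theta>(2) by (subst nn_integral_cmult) (simp_all add: second_moment_unit[OF \<theta>(1)])
  finally show ?thesis by (simp add: ennreal_mult r_def mult.commute)
qed

text \<open>
  By Parseval, the sum of the second moments in the \<open>n\<close> coordinate directions.
\<close>

lemma norm_moment: "(\<integral>\<^sup>+x\<in>K. ennreal ((norm_n n x)\<^sup>2) \<partial>lebesgue_n n) = ennreal (real n * L\<^sup>2)"
proof -
  define e :: "nat \<Rightarrow> nat \<Rightarrow> real" where "e i = (\<lambda>j\<in>{..<n}. if j = i then 1 else 0)" for i
  have inner_e: "inner_n n x (e i) = x i" if "i < n" for x i
  proof -
    have "inner_n n x (e i) = (\<Sum>j<n. if j = i then x j else 0)"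
      unfolding inner_n_def e_def by (intro sum.cong) auto
    then show ?thesis using that by simp
  qed
  have e: "e i \<in> space (lebesgue_n n)" "norm_n n (e i) = 1" if "i < n" for i
  proof -
    have "(norm_n n (e i))\<^sup>2 = 1"
      using that unfolding inner_n_self[symmetric] by (simp add: inner_e) (simp add: e_def)
    then show "norm_n n (e i) = 1"
      using L2_set_nonneg[of "e i" "{..<n}"] by (simp add: power2_eq_1_iff)
  qed (simp add: e_def space_lebesgue_n)
  have expand: "ennreal ((norm_n n x)\<^sup>2) * indicator K x = (\<Sum>i<n. ennreal ((inner_n n x (e i))\<^sup>2) * indicator K x)" for x
    by (simp add: L2_set_def sum_nonneg inner_e sum_ennreal flip: sum_distrib_right)
  have "(\<integral>\<^sup>+x\<in>K. ennreal ((norm_n n x)\<^sup>2) \<partial>lebesgue_n n)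
      = (\<Sum>i<n. (\<integral>\<^sup>+x\<in>K. ennreal ((inner_n n x (e i))\<^sup>2) \<partial>lebesgue_n n))"
    unfolding expand using e(1) by (subst nn_integral_sum) auto
  also have "\<dots> = (\<Sum>i<n. ennreal (L\<^sup>2))"
    using e by (intro sum.cong) (simp_all add: second_moment)
  finally show ?thesis by (simp add: ennreal_mult ennreal_of_nat_eq_real_of_nat)
qed

text \<open>
  Chebyshev's inequality, as the mean of \<open>\<langle>x, y\<rangle>\<^sup>2\<close> over \<open>x \<in> K\<close> is \<open>L\<^sup>2 * norm y ^ 2 \<le> L\<^sup>2\<close>.
\<close>

lemma slab_complement_small:
  assumes y: "y \<in> space (lebesgue_n n)" "norm_n n y \<le> 1"
  shows "measure (lebesgue_n n) {x \<in> K. 9 * L < \<bar>inner_n n x y\<bar>} \<le> 1 / 81"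
proof -
  have "ennreal ((9 * L)\<^sup>2) * emeasure (lebesgue_n n) {x \<in> K. 9 * L < \<bar>inner_n n x y\<bar>}
      = (\<integral>\<^sup>+x. ennreal ((9 * L)\<^sup>2) * indicator {x \<in> K. 9 * L < \<bar>inner_n n x y\<bar>} x \<partial>lebesgue_n n)"
    using y by (subst nn_integral_cmult_indicator) (auto intro!: sets_part)
  also have "\<dots> \<le> (\<integral>\<^sup>+x\<in>K. ennreal ((inner_n n x y)\<^sup>2) \<partial>lebesgue_n n)"
  proof (intro nn_integral_mono)
    fix x
    have "(9 * L)\<^sup>2 \<le> (inner_n n x y)\<^sup>2" if "9 * L < \<bar>inner_n n x y\<bar>"
      using that L_pos by (intro abs_le_square_iff[THEN iffD1]) auto
    then show "ennreal ((9 * L)\<^sup>2) * indicator {x \<in> K. 9 * L < \<bar>inner_n n x y\<bar>} x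
        \<le> ennreal ((inner_n n x y)\<^sup>2) * indicator K x"
      by (auto simp: indicator_def intro: ennreal_leI)
  qed
  also have "\<dots> = ennreal (L\<^sup>2 * (norm_n n y)\<^sup>2)" by (rule second_moment) fact
  also have "\<dots> \<le> ennreal (L\<^sup>2)"
    using y(2) by (intro ennreal_leI mult_left_le power_le_one) auto
  finally have "ennreal ((9 * L)\<^sup>2 * measure (lebesgue_n n) {x \<in> K. 9 * L < \<bar>inner_n n x y\<bar>}) \<le> ennreal (L\<^sup>2)"
    by (simp add: emeasure_part ennreal_mult)
  then have "81 * L\<^sup>2 * measure (lebesgue_n n) {x \<in> K. 9 * L < \<bar>inner_n n x y\<bar>} \<le> L\<^sup>2"
    by (simp add: ennreal_le_iff power_mult_distrib)
  then show ?thesis using L_pos by (simp add: field_simps)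
qed

definition mass_outside :: "real \<Rightarrow> real" where
  "mass_outside r = measure (lebesgue_n n) {x \<in> K. r < norm_n n x}"

text \<open>
  Borell's argument. If \<open>norm x > 3 * r\<close> and \<open>norm y \<le> r\<close>, then the midpoint of \<open>x\<close> and \<open>y\<close> has norm
  larger than \<open>(3 * r - r) / 2 = r\<close>, and by convexity it stays in \<open>K\<close>. The Brunn--Minkowski inequality
  turns this inclusion into an inequality between the measures.
\<close>

lemma borell_step:
  assumes r: "0 < r"
  shows "mass_outside (3 * r) * (1 - mass_outside r) \<le> (mass_outside r)\<^sup>2"
proof -
  have "emeasure (lebesgue_n n) {x \<in> K. 3 * r < norm_n n x} * emeasure (lebesgue_n n) {x \<in> K. \<not> r < norm_n n x}
      \<le> (emeasure (lebesgue_n n) {x \<in> K. r < norm_n n x})\<^sup>2"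
  proof (rule brunn_minkowski_midpoint)
    fix x y assume x: "x \<in> {x \<in> K. 3 * r < norm_n n x}" and y: "y \<in> {x \<in> K. \<not> r < norm_n n x}"
    define z where "z = (\<lambda>i\<in>{..<n}. (x i + y i) / 2)"
    have "\<forall>u\<in>{0..1}. (\<lambda>i\<in>{..<n}. (1 - u) * x i + u * y i) \<in> K"
      using convex x y unfolding convex_n_def by blast
    then have "(\<lambda>i\<in>{..<n}. (1 - 1/2) * x i + 1/2 * y i) \<in> K"
      by (rule bspec) simp
    also have "(\<lambda>i\<in>{..<n}. (1 - 1/2) * x i + 1/2 * y i) = z"
      by (auto simp: z_def fun_eq_iff)
    finally have "z \<in> K" .
    have "norm_n n x = L2_set (\<lambda>i. 2 * z i + - y i) {..<n}"
      by (intro L2_set_cong) (auto simp: z_def add_divide_distrib)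
    also have "\<dots> \<le> L2_set (\<lambda>i. 2 * z i) {..<n} + L2_set (\<lambda>i. - y i) {..<n}"
      by (rule L2_set_triangle_ineq)
    also have "L2_set (\<lambda>i. 2 * z i) {..<n} = 2 * norm_n n z"
      by (simp add: L2_set_right_distrib)
    also have "L2_set (\<lambda>i. - y i) {..<n} = norm_n n y"
      by (simp add: L2_set_def)
    finally have "r < norm_n n z" using x y by auto
    with \<open>z \<in> K\<close> show "z \<in> {x \<in> K. r < norm_n n x}" by simp
  qed (intro sets_part; measurable)+
  moreover have "measure (lebesgue_n n) {x \<in> K. \<not> r < norm_n n x} = 1 - mass_outside r"
    using measure_part_add[of "\<lambda>x. r < norm_n n x"] by (simp add: mass_outside_def)
  ultimately have "ennreal (mass_outside (3 * r)) * ennreal (1 - mass_outside r) \<le> (ennreal (mass_outside r))\<^sup>2"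
    unfolding emeasure_part by (simp add: mass_outside_def)
  then have "ennreal (mass_outside (3 * r) * (1 - mass_outside r)) \<le> ennreal ((mass_outside r)\<^sup>2)"
    by (simp only: ennreal_mult' ennreal_power mass_outside_def measure_nonneg)
  then show ?thesis by (subst (asm) ennreal_le_iff) auto
qed

text \<open>
  Once \<open>mass_outside r\<close> is small, each step of Borell's argument gains a factor \<open>1/18\<close>, which beats the factor
  \<open>9\<close> that the square of the radius gains when the radius is tripled.
\<close>

lemma mass_outside_geometric:
  assumes r: "0 < r" and small: "mass_outside r \<le> 1/36"
  shows "mass_outside (3 ^ k * r) \<le> 1/36 * (1/18) ^ k"
proof (induction k)
  case (Suc k)
  let ?q = "mass_outside (3 ^ k * r)"
  have "(1/18::real) ^ k \<le> 1" by (intro power_le_one) auto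
  with Suc have q: "?q \<le> 1/36" by simp
  have q0: "0 \<le> mass_outside s" for s by (simp add: mass_outside_def)
  have "mass_outside (3 ^ Suc k * r) * (1/2) \<le> mass_outside (3 ^ Suc k * r) * (1 - ?q)"
    using q q0 by (intro mult_left_mono) auto
  also have "\<dots> \<le> ?q\<^sup>2" using borell_step[of "3 ^ k * r"] r by (simp add: mult.assoc)
  also have "\<dots> \<le> 1/36 * ?q" unfolding power2_eq_square using q q0 by (intro mult_right_mono)
  finally show ?case using Suc by simp
qed (use small in simp)

text \<open>
  The mean of \<open>norm x ^ 2\<close> over \<open>K\<close> is \<open>n * L\<^sup>2\<close>. If at most \<open>1/36\<close> of the mass were outside the ball
  of radius \<open>r = sqrt n * L / 2\<close>, then the geometric decay of the mass in the shells between the radii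
  \<open>3 ^ k * r\<close> and \<open>3 ^ (k + 1) * r\<close> would bound this mean by \<open>(3/2) * r\<^sup>2\<close>, that is by
  \<open>(3/8) * n * L\<^sup>2\<close>.
\<close>

lemma mass_outside_large: "1/36 < mass_outside (sqrt n * L / 2)"
proof (rule ccontr)
  define r where "r = sqrt n * L / 2"
  have r: "0 < r" using dim L_pos by (simp add: r_def)
  assume "\<not> 1/36 < mass_outside (sqrt n * L / 2)"
  then have q: "mass_outside (3 ^ k * r) \<le> 1/36 * (1/18) ^ k" for k
    by (intro mass_outside_geometric r) (simp add: r_def)
  define A where "A k = {x \<in> K. 3 ^ k * r < norm_n n x}" for k
  have A[measurable]: "A k \<in> sets (lebesgue_n n)" for k
    unfolding A_def by (intro sets_part) measurable
  have term_le: "g k \<le> (\<Sum>k. g k)" for g :: "nat \<Rightarrow> ennreal" and k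
    using sum_le_suminf[of g "{k}"] by simp
  have shells: "ennreal ((norm_n n x)\<^sup>2) * indicator K x
      \<le> ennreal (r\<^sup>2) * indicator K x + (\<Sum>k. ennreal (9 ^ Suc k * r\<^sup>2) * indicator (A k) x)" for x
  proof (cases "x \<in> K \<and> r < norm_n n x")
    case True
    obtain m where "norm_n n x / r < 3 ^ m"
      using real_arch_pow[of 3] by auto
    then have ex: "norm_n n x \<le> 3 ^ m * r" using r by (simp add: field_simps)
    define N where "N = (LEAST m. norm_n n x \<le> 3 ^ m * r)"
    have N: "norm_n n x \<le> 3 ^ N * r" unfolding N_def by (rule LeastI) (rule ex)
    then obtain k where k: "N = Suc k" using True by (cases N) auto
    then have "\<not> norm_n n x \<le> 3 ^ k * r"
      using not_less_Least[of k "\<lambda>m. norm_n n x \<le> 3 ^ m * r"] by (simp add: N_def)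
    then have xA: "x \<in> A k" using True by (simp add: A_def)
    have "(norm_n n x)\<^sup>2 \<le> (3 ^ Suc k * r)\<^sup>2"
      using N k by (intro power_mono) auto
    also have "\<dots> = 9 ^ Suc k * r\<^sup>2"
      by (simp add: power_mult_distrib flip: power_mult) (simp add: power_mult power2_eq_square mult.commute[of k])
    finally have "ennreal ((norm_n n x)\<^sup>2) * indicator K x \<le> ennreal (9 ^ Suc k * r\<^sup>2) * indicator (A k) x"
      using True xA by (simp add: ennreal_leI)
    also have "\<dots> \<le> (\<Sum>k. ennreal (9 ^ Suc k * r\<^sup>2) * indicator (A k) x)"
      by (rule term_le)
    finally show ?thesis by (rule order_trans) simp
  next
    case False
    then have "ennreal ((norm_n n x)\<^sup>2) * indicator K x \<le> ennreal (r\<^sup>2) * indicator K x"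
      by (auto simp: indicator_def intro!: ennreal_leI power_mono)
    then show ?thesis by (rule order_trans) simp
  qed
  have "ennreal (real n * L\<^sup>2) \<le> (\<integral>\<^sup>+x. ennreal (r\<^sup>2) * indicator K x
      + (\<Sum>k. ennreal (9 ^ Suc k * r\<^sup>2) * indicator (A k) x) \<partial>lebesgue_n n)"
    unfolding norm_moment[symmetric] by (intro nn_integral_mono shells)
  also have "\<dots> = ennreal (r\<^sup>2) + (\<Sum>k. ennreal (9 ^ Suc k * r\<^sup>2) * emeasure (lebesgue_n n) (A k))"
    by (simp add: nn_integral_add nn_integral_suminf nn_integral_cmult_indicator volume)
  also have "\<dots> \<le> ennreal (r\<^sup>2) + (\<Sum>k. ennreal (r\<^sup>2 / 4 * (1/2) ^ k))"
  proof (intro add_left_mono suminf_le)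
    fix k
    have "9 ^ Suc k * r\<^sup>2 * mass_outside (3 ^ k * r) \<le> 9 ^ Suc k * r\<^sup>2 * (1/36 * (1/18) ^ k)"
      by (intro mult_left_mono q) auto
    also have "\<dots> = r\<^sup>2 / 4 * (9 * (1/18)) ^ k"
      unfolding power_mult_distrib by simp
    finally have "ennreal (9 ^ Suc k * r\<^sup>2 * mass_outside (3 ^ k * r)) \<le> ennreal (r\<^sup>2 / 4 * (1/2) ^ k)"
      by (intro ennreal_leI) simp
    then show "ennreal (9 ^ Suc k * r\<^sup>2) * emeasure (lebesgue_n n) (A k) \<le> ennreal (r\<^sup>2 / 4 * (1/2) ^ k)"
      unfolding A_def emeasure_part by (simp add: mass_outside_def ennreal_mult)
  qed auto
  also have "(\<Sum>k. ennreal (r\<^sup>2 / 4 * (1/2) ^ k)) = ennreal (r\<^sup>2 / 2)"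
  proof (rule suminf_ennreal_eq)
    have "(\<lambda>k. r\<^sup>2 / 4 * (1/2) ^ k) sums (r\<^sup>2 / 4 * (1 / (1 - 1/2)))"
      by (intro sums_mult geometric_sums) simp
    then show "(\<lambda>k. r\<^sup>2 / 4 * (1/2) ^ k) sums (r\<^sup>2 / 2)" by simp
  qed simp
  also have "ennreal (r\<^sup>2) + ennreal (r\<^sup>2 / 2) = ennreal (3/8 * (real n * L\<^sup>2))"
    by (simp add: r_def power_divide power_mult_distrib flip: ennreal_plus)
  finally have "real n * L\<^sup>2 \<le> 3/8 * (real n * L\<^sup>2)"
    by (subst (asm) ennreal_le_iff) auto
  moreover have "0 < real n * L\<^sup>2" using dim L_pos by simp
  ultimately show False by linarith
qed

end

section \<open>From the sphere to the ball\<close>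

lemma punctured_ball_eq:
  "punctured_ball n = {x \<in> space (lebesgue_n n). 0 < norm_n n x \<and> norm_n n x \<le> 1}"
  by (simp add: punctured_ball_def space_lebesgue_n)

lemma sets_punctured_ball [measurable]: "punctured_ball n \<in> sets (lebesgue_n n)"
  unfolding punctured_ball_eq by measurable

lemma emeasure_punctured_ball:
  assumes "n \<ge> 1"
  shows "0 < emeasure (lebesgue_n n) (punctured_ball n)" "emeasure (lebesgue_n n) (punctured_ball n) < top"
proof -
  interpret product_sigma_finite "\<lambda>_ :: nat. lborel :: real measure" by standard
  have box: "emeasure (lebesgue_n n) (Pi\<^sub>E {..<n} (\<lambda>_. X)) = emeasure lborel X ^ n"
    if "X \<in> sets lborel" for X
    unfolding lebesgue_n_def using that by (subst emeasure_PiM) auto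
  have box_sets: "Pi\<^sub>E {..<n} (\<lambda>_. X) \<in> sets (lebesgue_n n)" if "X \<in> sets lborel" for X
    unfolding lebesgue_n_def using that by (intro sets_PiM_I_finite) auto
  \<comment> \<open>The ball is compared with a cube that contains it and with a small cube in the positive orthant,
    half open so that it misses the origin.\<close>
  have "punctured_ball n \<subseteq> Pi\<^sub>E {..<n} (\<lambda>_. {-1..1})"
  proof
    fix x assume x: "x \<in> punctured_ball n"
    have "x i \<in> {-1..1}" if "i < n" for i
    proof -
      have "(x i)\<^sup>2 \<le> (\<Sum>i<n. (x i)\<^sup>2)"
        using that by (intro member_le_sum) auto
      also have "\<dots> = (norm_n n x)\<^sup>2" by (simp add: L2_set_def sum_nonneg)
      also have "\<dots> \<le> 1" using x by (simp add: punctured_ball_def power_le_one)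
      finally have "\<bar>x i\<bar> \<le> 1" by (simp add: abs_square_le_1)
      then show ?thesis by (simp add: abs_le_iff)
    qed
    then show "x \<in> Pi\<^sub>E {..<n} (\<lambda>_. {-1..1})"
      using x by (simp add: punctured_ball_def PiE_iff)
  qed
  then have "emeasure (lebesgue_n n) (punctured_ball n) \<le> emeasure lborel {-1..1::real} ^ n"
    by (subst box[symmetric]) (auto intro!: emeasure_mono box_sets)
  then show "emeasure (lebesgue_n n) (punctured_ball n) < top"
    by (rule le_less_trans) (simp add: power_less_top_ennreal)
  have "Pi\<^sub>E {..<n} (\<lambda>_. {0<..1 / real n}) \<subseteq> punctured_ball n"
  proof
    fix x assume x: "x \<in> Pi\<^sub>E {..<n} (\<lambda>_. {0<..1 / real n})"
    have "norm_n n x \<le> (\<Sum>i<n. \<bar>x i\<bar>)" by (rule L2_set_le_sum_abs)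
    also have "\<dots> \<le> (\<Sum>i<n. 1 / real n)"
    proof (rule sum_mono)
      fix i assume "i \<in> {..<n}"
      then show "\<bar>x i\<bar> \<le> 1 / real n" using PiE_mem[OF x, of i] by simp
    qed
    also have "\<dots> = 1" using assms by simp
    finally have "norm_n n x \<le> 1" .
    moreover have "norm_n n x \<noteq> 0"
    proof
      assume "norm_n n x = 0"
      then have "x 0 = 0" using assms by (simp add: L2_set_eq_0_iff)
      then show False using PiE_mem[OF x, of 0] assms by simp
    qed
    ultimately show "x \<in> punctured_ball n"
      using x by (simp add: punctured_ball_def PiE_iff less_le)
  qed
  then have "emeasure lborel {0<..1 / real n} ^ n \<le> emeasure (lebesgue_n n) (punctured_ball n)"
    by (subst box[symmetric]) (auto intro!: emeasure_mono)
  moreover have "0 < emeasure lborel {0<..1 / real n} ^ n"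
    using assms by (simp add: ennreal_power)
  ultimately show "0 < emeasure (lebesgue_n n) (punctured_ball n)"
    by (rule less_le_trans[rotated])
qed

lemma nn_integral_sphere_measure:
  assumes f[measurable]: "f \<in> borel_measurable (lebesgue_n n)"
  shows "(\<integral>\<^sup>+\<theta>. f \<theta> \<partial>sphere_measure n)
    = (\<integral>\<^sup>+y\<in>punctured_ball n. f (\<lambda>i\<in>{..<n}. y i / norm_n n y) \<partial>lebesgue_n n)
      / emeasure (lebesgue_n n) (punctured_ball n)"
proof -
  let ?B = "punctured_ball n" and ?S = "unit_sphere n"
  let ?U = "uniform_measure (lebesgue_n n) ?B"
  let ?p = "\<lambda>y. \<lambda>i\<in>{..<n}. y i / norm_n n y"
  have p[measurable]: "?p \<in> measurable (lebesgue_n n) (lebesgue_n n)"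
  proof (rule measurable_restrict_n)
    fix i assume "i < n"
    then have [measurable]: "(\<lambda>y. y i) \<in> borel_measurable (lebesgue_n n)"
      by (intro measurable_coordinate_n[of "\<lambda>y. y"]) auto
    show "(\<lambda>y. y i / norm_n n y) \<in> borel_measurable (lebesgue_n n)" by measurable
  qed
  have "?p \<in> measurable (restrict_space ?U ?B) (restrict_space (lebesgue_n n) ?S)"
  proof (rule measurable_restrict_space3)
    show "?p \<in> measurable ?U (lebesgue_n n)"
      using p by (simp cong: measurable_cong_sets)
    show "?p \<in> ?B \<rightarrow> ?S"
    proof (rule funcsetI)
      fix y assume "y \<in> ?B"
      then have "norm_n n y \<noteq> 0" by (simp add: punctured_ball_def)
      then show "?p y \<in> ?S" by (rule unit_sphere_normalized)
    qed
  qed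
  then have "(\<integral>\<^sup>+\<theta>. f \<theta> \<partial>sphere_measure n) = (\<integral>\<^sup>+y. f (?p y) \<partial>restrict_space ?U ?B)"
    unfolding sphere_measure_def
    by (intro nn_integral_distr) (auto intro!: measurable_restrict_space1)
  also have "\<dots> = (\<integral>\<^sup>+y. f (?p y) * indicator ?B y \<partial>?U)"
    by (intro nn_integral_restrict_space) simp
  also have "\<dots> = (\<integral>\<^sup>+y. f (?p y) * indicator ?B y * indicator ?B y \<partial>lebesgue_n n) / emeasure (lebesgue_n n) ?B"
    by (intro nn_integral_uniform_measure) measurable
  also have "(\<integral>\<^sup>+y. f (?p y) * indicator ?B y * indicator ?B y \<partial>lebesgue_n n)
      = (\<integral>\<^sup>+y. f (?p y) * indicator ?B y \<partial>lebesgue_n n)"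
    by (intro nn_integral_cong) (simp add: indicator_def)
  finally show ?thesis .
qed

text \<open>
  This is the \<open>n/2\<close>-th power of \<open>exp (- 2 * u) \<le> 1 / (1 + 2 * u) \<le> 1 - u\<close>, where the second step uses
  \<open>(1 + 2 * u) * (1 - u) = 1 + u * (1 - 2 * u) \<ge> 1\<close>.
\<close>

lemma exp_le_power_one_minus:
  fixes u :: real
  assumes "0 \<le> u" "u \<le> 1/2"
  shows "exp (- (real n * u)) \<le> sqrt (1 - u) ^ n"
proof -
  have "exp (- (2 * u)) \<le> 1 / (1 + 2 * u)"
    using exp_ge_add_one_self[of "2 * u"] assms by (simp add: exp_minus field_simps)
  also have "\<dots> \<le> 1 - u"
  proof -
    have "u * (1 - 2 * u) \<ge> 0" using assms by (intro mult_nonneg_nonneg) auto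
    then show ?thesis using assms by (simp add: field_simps)
  qed
  finally have "(exp (- u))\<^sup>2 \<le> 1 - u" by (simp flip: exp_of_nat_mult)
  then have "exp (- u) \<le> sqrt (1 - u)" by (rule real_le_rsqrt)
  then have "exp (- u) ^ n \<le> sqrt (1 - u) ^ n" by (intro power_mono) auto
  then show ?thesis by (simp flip: exp_of_nat_mult)
qed

lemma measurable_emeasure_section:
  assumes [measurable]: "B \<in> sets (lebesgue_n n)"
    and [measurable]: "Measurable.pred (lebesgue_n n \<Otimes>\<^sub>M lebesgue_n n) (\<lambda>w. P (fst w) (snd w))"
  shows "(\<lambda>x. emeasure (lebesgue_n n) {y \<in> B. P x y}) \<in> borel_measurable (lebesgue_n n)"
proof -
  interpret sigma_finite_measure "lebesgue_n n" by (rule sigma_finite_lebesgue_n)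
  define Q where "Q = {w \<in> space (lebesgue_n n \<Otimes>\<^sub>M lebesgue_n n). snd w \<in> B \<and> P (fst w) (snd w)}"
  have "Q \<in> sets (lebesgue_n n \<Otimes>\<^sub>M lebesgue_n n)" unfolding Q_def by measurable
  then have "(\<lambda>x. emeasure (lebesgue_n n) (Pair x -` Q)) \<in> borel_measurable (lebesgue_n n)"
    by (rule measurable_emeasure_Pair)
  moreover have "Pair x -` Q = {y \<in> B. P x y}" if "x \<in> space (lebesgue_n n)" for x
    using that sets.sets_into_space[OF assms(1)] by (auto simp: Q_def space_pair_measure)
  ultimately show ?thesis by (simp cong: measurable_cong)
qed

context isotropic_body
begin

text \<open>
  Since the measure on the sphere is the cone measure, the average over directions \<open>\<theta>\<close> is the average
  over points \<open>y\<close> of the ball with \<open>\<theta> = y / norm y\<close>. Multiplying by the volume of the ball avoids a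
  quotient.
\<close>

lemma avg_tail_eq:
  assumes t: "0 \<le> t"
  shows "ennreal (avg_tail n K t) * emeasure (lebesgue_n n) (punctured_ball n)
    = (\<integral>\<^sup>+y\<in>punctured_ball n.
        emeasure (lebesgue_n n) {x \<in> K. t * L * norm_n n y \<le> \<bar>inner_n n x y\<bar>} \<partial>lebesgue_n n)"
proof -
  let ?B = "punctured_ball n"
  let ?E = "\<lambda>\<theta>. {x \<in> K. t * L \<le> \<bar>inner_n n x \<theta>\<bar>}"
  have em[measurable]: "(\<lambda>\<theta>. emeasure (lebesgue_n n) (?E \<theta>)) \<in> borel_measurable (lebesgue_n n)"
    by (rule measurable_emeasure_section) measurable
  have m: "(\<lambda>\<theta>. measure (lebesgue_n n) (?E \<theta>)) \<in> borel_measurable (sphere_measure n)"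
  proof -
    have "(\<lambda>\<theta>. measure (lebesgue_n n) (?E \<theta>)) \<in> borel_measurable (lebesgue_n n)"
      unfolding measure_def by measurable
    then have "(\<lambda>\<theta>. measure (lebesgue_n n) (?E \<theta>)) \<in> borel_measurable (restrict_space (lebesgue_n n) (unit_sphere n))"
      by (rule measurable_restrict_space1)
    then show ?thesis by (simp add: sphere_measure_def)
  qed
  have b: "0 < emeasure (lebesgue_n n) ?B" "emeasure (lebesgue_n n) ?B < top"
    using emeasure_punctured_ball[OF dim] by auto
  define X where "X = (\<integral>\<^sup>+y\<in>?B. emeasure (lebesgue_n n) {x \<in> K. t * L * norm_n n y \<le> \<bar>inner_n n x y\<bar>} \<partial>lebesgue_n n)"
  have "X \<le> (\<integral>\<^sup>+y. indicator ?B y \<partial>lebesgue_n n)"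
    unfolding X_def
  proof (intro nn_integral_mono)
    fix y
    have "emeasure (lebesgue_n n) {x \<in> K. t * L * norm_n n y \<le> \<bar>inner_n n x y\<bar>} \<le> 1"
      unfolding volume[symmetric] by (intro emeasure_mono) auto
    then show "emeasure (lebesgue_n n) {x \<in> K. t * L * norm_n n y \<le> \<bar>inner_n n x y\<bar>} * indicator ?B y
        \<le> indicator ?B y"
      by (auto simp: indicator_def)
  qed
  then have X_fin: "X < top" using b by (auto intro: le_less_trans)
  have const: "isotropic_constant n K = L"
    by (rule isotropic_constant_eq) (use dim second_moments in auto)
  have "avg_tail n K t = enn2real (\<integral>\<^sup>+\<theta>. ennreal (measure (lebesgue_n n) (?E \<theta>)) \<partial>sphere_measure n)"
    unfolding avg_tail_def const by (intro integral_eq_nn_integral m) auto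
  also have "(\<integral>\<^sup>+\<theta>. ennreal (measure (lebesgue_n n) (?E \<theta>)) \<partial>sphere_measure n)
      = (\<integral>\<^sup>+\<theta>. emeasure (lebesgue_n n) (?E \<theta>) \<partial>sphere_measure n)"
    by (simp add: emeasure_part)
  also have "\<dots> = (\<integral>\<^sup>+y\<in>?B. emeasure (lebesgue_n n) (?E (\<lambda>i\<in>{..<n}. y i / norm_n n y)) \<partial>lebesgue_n n)
      / emeasure (lebesgue_n n) ?B"
    by (rule nn_integral_sphere_measure) (rule em)
  also have "(\<integral>\<^sup>+y\<in>?B. emeasure (lebesgue_n n) (?E (\<lambda>i\<in>{..<n}. y i / norm_n n y)) \<partial>lebesgue_n n) = X"
    unfolding X_def
  proof (intro nn_integral_cong)
    fix y
    have "?E (\<lambda>i\<in>{..<n}. y i / norm_n n y) = {x \<in> K. t * L * norm_n n y \<le> \<bar>inner_n n x y\<bar>}"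
      if "y \<in> ?B"
      using that unfolding inner_n_scale by (auto simp: punctured_ball_def field_simps)
    then show "emeasure (lebesgue_n n) (?E (\<lambda>i\<in>{..<n}. y i / norm_n n y)) * indicator ?B y
        = emeasure (lebesgue_n n) {x \<in> K. t * L * norm_n n y \<le> \<bar>inner_n n x y\<bar>} * indicator ?B y"
      by (auto simp: indicator_def)
  qed
  finally have avg: "avg_tail n K t = enn2real (X / emeasure (lebesgue_n n) ?B)" .
  have "X / emeasure (lebesgue_n n) ?B \<noteq> top"
    using X_fin b by (auto simp: ennreal_divide_eq_top_iff)
  then have "ennreal (avg_tail n K t) = X / emeasure (lebesgue_n n) ?B"
    unfolding avg by (simp add: less_top)
  also have "\<dots> * emeasure (lebesgue_n n) ?B = X * emeasure (lebesgue_n n) ?B / emeasure (lebesgue_n n) ?B"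
    by (simp add: ennreal_times_divide mult.commute)
  also have "\<dots> = X"
    using b by (intro ennreal_mult_divide_eq) auto
  finally show ?thesis unfolding X_def .
qed

section \<open>The lower bound for the averaged tail\<close>

text \<open>
  The point \<open>z\<close> arises from \<open>y\<close> by shrinking with the factor \<open>\<rho>\<close> and moving the distance \<open>a\<close> in the
  direction of \<open>x\<close>. The move contributes \<open>a * norm x \<ge> 10 * t * L\<close> to the inner product with \<open>x\<close>,
  and the shrunken \<open>y\<close> takes away at most \<open>9 * L\<close>. Because \<open>y\<close> is nearly orthogonal to \<open>x\<close>, the mixed
  term in \<open>norm z ^ 2\<close> is at most \<open>36 * a / sqrt n\<close>, hence at most \<open>2 * a\<^sup>2\<close>, so that
  \<open>\<rho>\<^sup>2 = 1 - 3 * a\<^sup>2\<close> leaves enough room for \<open>z\<close> in the ball.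
\<close>

lemma displaced_ball_point:
  assumes x: "sqrt n * L / 2 < norm_n n x"
    and y: "y \<in> punctured_ball n" "\<bar>inner_n n x y\<bar> \<le> 9 * L"
    and t: "1 \<le> t" and \<rho>: "0 \<le> \<rho>" "\<rho>\<^sup>2 = 1 - 1200 * t\<^sup>2 / n"
  defines "a \<equiv> 20 * t / sqrt n"
  defines "z \<equiv> \<lambda>i\<in>{..<n}. a / norm_n n x * x i + \<rho> * y i"
  shows "z \<in> punctured_ball n" "t * L \<le> \<bar>inner_n n x z\<bar>"
proof -
  have sn: "0 < sqrt n" using dim by simp
  have a: "0 < a" using t sn by (simp add: a_def)
  have nx: "0 < norm_n n x" using less_trans[OF _ x, of 0] sn L_pos by simp
  have \<rho>1: "\<rho> \<le> 1"
  proof (rule power2_le_imp_le)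
    show "\<rho>\<^sup>2 \<le> 1\<^sup>2" using \<rho> by simp
  qed simp
  have "inner_n n x z = a / norm_n n x * (norm_n n x)\<^sup>2 + \<rho> * inner_n n x y"
    unfolding z_def inner_n_combination inner_n_self ..
  then have ixz: "inner_n n x z = a * norm_n n x + \<rho> * inner_n n x y"
    using nx by (simp add: power2_eq_square)
  have "\<bar>\<rho> * inner_n n x y\<bar> \<le> 1 * (9 * L)"
    unfolding abs_mult using \<rho> \<rho>1 y by (intro mult_mono) auto
  moreover have "a * (sqrt n * L / 2) \<le> a * norm_n n x"
    using x a by (intro mult_left_mono) auto
  moreover have "a * (sqrt n * L / 2) = 10 * t * L" using sn by (simp add: a_def)
  ultimately have "10 * t * L - 9 * L \<le> inner_n n x z" using ixz by linarith
  moreover have "9 * L \<le> 9 * t * L" using t L_pos by simp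
  ultimately have lower: "t * L \<le> inner_n n x z" by simp
  then show "t * L \<le> \<bar>inner_n n x z\<bar>" by simp
  have "0 < t * L" using t L_pos by simp
  then have "norm_n n z \<noteq> 0"
    using lower norm_n_eq_0_imp_inner_n[where n = n and x = x and y = z] by auto
  then have pos: "0 < norm_n n z" using L2_set_nonneg[of z "{..<n}"] by linarith
  have "(norm_n n z)\<^sup>2 = (a / norm_n n x)\<^sup>2 * (norm_n n x)\<^sup>2 + 2 * (a / norm_n n x) * \<rho> * inner_n n x y + \<rho>\<^sup>2 * (norm_n n y)\<^sup>2"
    unfolding z_def by (rule norm_n_combination)
  also have "(a / norm_n n x)\<^sup>2 * (norm_n n x)\<^sup>2 = a\<^sup>2" using nx by (simp add: power_divide)
  also have "2 * (a / norm_n n x) * \<rho> * inner_n n x y \<le> 2 * (a / norm_n n x) * (1 * (9 * L))"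
    using \<open>\<bar>\<rho> * inner_n n x y\<bar> \<le> 1 * (9 * L)\<close> a nx
    unfolding mult.assoc by (intro mult_left_mono) auto
  also have "2 * (a / norm_n n x) * (1 * (9 * L)) \<le> 2 * (a / (sqrt n * L / 2)) * (1 * (9 * L))"
    using a nx x sn L_pos by (intro mult_right_mono mult_left_mono divide_left_mono) auto
  also have "2 * (a / (sqrt n * L / 2)) * (1 * (9 * L)) = 36 * a / sqrt n"
    using L_pos by (simp add: field_simps)
  \<comment> \<open>Here \<open>t \<ge> 1\<close> enters: it gives \<open>1 / sqrt n \<le> a / 20\<close>.\<close>
  also have "36 * a / sqrt n \<le> 36 * a * (a / 20)"
    using a t sn by (simp add: a_def divide_simps)
  also have "\<rho>\<^sup>2 * (norm_n n y)\<^sup>2 \<le> \<rho>\<^sup>2 * 1"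
    using y by (intro mult_left_mono power_le_one) (auto simp: punctured_ball_def)
  finally have "(norm_n n z)\<^sup>2 \<le> a\<^sup>2 + 36 * a * (a / 20) + \<rho>\<^sup>2 * 1" by simp
  also have "\<dots> \<le> 3 * a\<^sup>2 + \<rho>\<^sup>2" by (simp add: power2_eq_square)
  also have "3 * a\<^sup>2 = 1200 * t\<^sup>2 / n" by (simp add: a_def power_divide power_mult_distrib)
  finally have "(norm_n n z)\<^sup>2 \<le> 1\<^sup>2" using \<rho> by simp
  then have "norm_n n z \<le> 1" by (rule power2_le_imp_le) simp
  with pos show "z \<in> punctured_ball n" by (simp add: punctured_ball_def z_def)
qed

text \<open>
  For a fixed \<open>y\<close> in the ball, at least \<open>1/36 - 1/81 = 5/324\<close> of the mass of \<open>K\<close> consists of points \<open>x\<close>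
  that are far from the origin and satisfy \<open>\<bar>\<langle>x, y\<rangle>\<bar> \<le> 9 * L\<close>. After exchanging the roles of \<open>x\<close> and
  \<open>y\<close> by Fubini, the homothety of the previous lemma moves, for each such \<open>x\<close>, the set of these \<open>y\<close>
  into \<open>{z. t * L \<le> \<bar>\<langle>x, z\<rangle>\<bar>}\<close> at the cost of the volume factor \<open>\<rho> ^ n \<ge> exp (- 1200 * t\<^sup>2)\<close>.
\<close>

lemma avg_tail_lower_bound:
  fixes t :: real
  assumes t: "1 \<le> t" and tn: "2500 * t\<^sup>2 \<le> n"
  shows "exp (- (2500 * t\<^sup>2)) \<le> avg_tail n K t"
proof -
  let ?B = "punctured_ball n" and ?l = "lebesgue_n n"
  define u where "u = 1200 * t\<^sup>2 / n"
  define \<rho> where "\<rho> = sqrt (1 - u)"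
  have n: "0 < real n" using dim by simp
  have u: "0 \<le> u" "u \<le> 1/2" using tn n by (auto simp: u_def field_simps)
  have \<rho>: "0 < \<rho>" "\<rho>\<^sup>2 = 1 - 1200 * t\<^sup>2 / n" using u by (auto simp: \<rho>_def u_def)
  define D where "D = {x \<in> K. sqrt n * L / 2 < norm_n n x}"
  have D[measurable]: "D \<in> sets ?l" unfolding D_def by (intro sets_part) measurable
  have D_sub: "D \<subseteq> K" by (auto simp: D_def)
  have sets_B: "{y \<in> ?B. P y} \<in> sets ?l" if [measurable]: "Measurable.pred ?l P" for P
  proof -
    have "{y \<in> ?B. P y} = ?B \<inter> {y \<in> space ?l. P y}" by (auto simp: punctured_ball_eq)
    then show ?thesis by simp
  qed
  have inner_m: "Measurable.pred ?l (\<lambda>y. c \<le> \<bar>inner_n n x y\<bar>)" "Measurable.pred ?l (\<lambda>y. \<bar>inner_n n x y\<bar> \<le> c)"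
    if [measurable]: "x \<in> space ?l" for x c
    by measurable
  have pos_part: "ennreal (5/324) \<le> emeasure ?l {x \<in> D. \<bar>inner_n n x y\<bar> \<le> 9 * L}" if y: "y \<in> ?B" for y
  proof -
    have y': "y \<in> space ?l" "norm_n n y \<le> 1" using y by (auto simp: punctured_ball_eq)
    note measurable_inner[OF y'(1), measurable]
    let ?F = "{x \<in> D. \<bar>inner_n n x y\<bar> \<le> 9 * L}" and ?G = "{x \<in> K. 9 * L < \<bar>inner_n n x y\<bar>}"
    have F_eq: "?F = {x \<in> K. sqrt n * L / 2 < norm_n n x \<and> \<bar>inner_n n x y\<bar> \<le> 9 * L}"
      by (auto simp: D_def)
    have em_F: "emeasure ?l ?F = ennreal (measure ?l ?F)"
      unfolding F_eq by (rule emeasure_part)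
    have em_D: "emeasure ?l D = ennreal (measure ?l D)"
      unfolding D_def by (rule emeasure_part)
    have [measurable]: "?F \<in> sets ?l" "?G \<in> sets ?l"
      unfolding F_eq by (intro sets_part; measurable)+
    have "emeasure ?l D \<le> emeasure ?l (?F \<union> ?G)"
      by (intro emeasure_mono) (auto simp: D_def)
    also have "\<dots> \<le> emeasure ?l ?F + emeasure ?l ?G"
      by (intro emeasure_subadditive) auto
    finally have "ennreal (measure ?l D) \<le> ennreal (measure ?l ?F + measure ?l ?G)"
      by (simp only: em_F em_D emeasure_part ennreal_plus measure_nonneg)
    then have "measure ?l D \<le> measure ?l ?F + measure ?l ?G"
      by (subst (asm) ennreal_le_iff) auto
    moreover have "1/36 < measure ?l D"
      using mass_outside_large by (simp add: mass_outside_def D_def)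
    ultimately have "5/324 \<le> measure ?l ?F"
      using slab_complement_small[OF y'] by simp
    then show ?thesis unfolding em_F by (rule ennreal_leI)
  qed
  have "ennreal (\<rho> ^ n) * ennreal (5/324) * emeasure ?l ?B
      = ennreal (\<rho> ^ n) * (\<integral>\<^sup>+y. ennreal (5/324) * indicator ?B y \<partial>?l)"
    by (subst nn_integral_cmult_indicator) (simp_all add: mult.assoc)
  also have "\<dots> \<le> ennreal (\<rho> ^ n) * (\<integral>\<^sup>+y\<in>?B. emeasure ?l {x \<in> D. \<bar>inner_n n x y\<bar> \<le> 9 * L} \<partial>?l)"
    using pos_part by (intro mult_left_mono nn_integral_mono) (auto simp: indicator_def)
  also have "\<dots> = ennreal (\<rho> ^ n) * (\<integral>\<^sup>+x\<in>D. emeasure ?l {y \<in> ?B. \<bar>inner_n n x y\<bar> \<le> 9 * L} \<partial>?l)"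
    by (subst nn_integral_sections_swap) (auto simp: split_beta')
  also have "\<dots> = (\<integral>\<^sup>+x. ennreal (\<rho> ^ n) * (emeasure ?l {y \<in> ?B. \<bar>inner_n n x y\<bar> \<le> 9 * L} * indicator D x) \<partial>?l)"
  proof (rule nn_integral_cmult[symmetric])
    have [measurable]: "(\<lambda>x. emeasure ?l {y \<in> ?B. \<bar>inner_n n x y\<bar> \<le> 9 * L}) \<in> borel_measurable ?l"
      by (rule measurable_emeasure_section) measurable
    show "(\<lambda>x. emeasure ?l {y \<in> ?B. \<bar>inner_n n x y\<bar> \<le> 9 * L} * indicator D x) \<in> borel_measurable ?l"
      by measurable
  qed
  also have "\<dots> \<le> (\<integral>\<^sup>+x\<in>K. emeasure ?l {y \<in> ?B. t * L \<le> \<bar>inner_n n x y\<bar>} \<partial>?l)"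
  proof (intro nn_integral_mono)
    fix x assume xs: "x \<in> space ?l"
    have "ennreal (\<rho> ^ n) * emeasure ?l {y \<in> ?B. \<bar>inner_n n x y\<bar> \<le> 9 * L}
        \<le> emeasure ?l {y \<in> ?B. t * L \<le> \<bar>inner_n n x y\<bar>}" if x: "x \<in> D"
    proof (rule emeasure_homothety_le)
      show "{y \<in> ?B. \<bar>inner_n n x y\<bar> \<le> 9 * L} \<in> sets ?l" "{y \<in> ?B. t * L \<le> \<bar>inner_n n x y\<bar>} \<in> sets ?l"
        by (intro sets_B inner_m xs)+
      fix y assume y: "y \<in> {y \<in> ?B. \<bar>inner_n n x y\<bar> \<le> 9 * L}"
      show "(\<lambda>i\<in>{..<n}. 20 * t / sqrt n / norm_n n x * x i + \<rho> * y i) \<in> {y \<in> ?B. t * L \<le> \<bar>inner_n n x y\<bar>}"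
        using displaced_ball_point[of x y t \<rho>] x y t \<rho> by (simp add: D_def)
    qed (rule \<rho>)
    then show "ennreal (\<rho> ^ n) * (emeasure ?l {y \<in> ?B. \<bar>inner_n n x y\<bar> \<le> 9 * L} * indicator D x)
        \<le> emeasure ?l {y \<in> ?B. t * L \<le> \<bar>inner_n n x y\<bar>} * indicator K x"
      using D_sub by (auto simp: indicator_def)
  qed
  also have "\<dots> = (\<integral>\<^sup>+y\<in>?B. emeasure ?l {x \<in> K. t * L \<le> \<bar>inner_n n x y\<bar>} \<partial>?l)"
    by (subst nn_integral_sections_swap) (auto simp: split_beta')
  also have "\<dots> \<le> (\<integral>\<^sup>+y\<in>?B. emeasure ?l {x \<in> K. t * L * norm_n n y \<le> \<bar>inner_n n x y\<bar>} \<partial>?l)"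
  proof (intro nn_integral_mono)
    fix y assume [measurable]: "y \<in> space ?l"
    have "emeasure ?l {x \<in> K. t * L \<le> \<bar>inner_n n x y\<bar>} \<le> emeasure ?l {x \<in> K. t * L * norm_n n y \<le> \<bar>inner_n n x y\<bar>}"
      if "y \<in> ?B"
    proof (intro emeasure_mono sets_part)
      have "t * L * norm_n n y \<le> t * L"
        using that t L_pos by (intro mult_left_le) (auto simp: punctured_ball_def)
      then show "{x \<in> K. t * L \<le> \<bar>inner_n n x y\<bar>} \<subseteq> {x \<in> K. t * L * norm_n n y \<le> \<bar>inner_n n x y\<bar>}"
        by auto
    qed measurable
    then show "emeasure ?l {x \<in> K. t * L \<le> \<bar>inner_n n x y\<bar>} * indicator ?B y
        \<le> emeasure ?l {x \<in> K. t * L * norm_n n y \<le> \<bar>inner_n n x y\<bar>} * indicator ?B y"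
      by (auto simp: indicator_def)
  qed
  also have "\<dots> = ennreal (avg_tail n K t) * emeasure ?l ?B"
    using t by (intro avg_tail_eq[symmetric]) simp
  finally have "ennreal (\<rho> ^ n) * ennreal (5/324) * emeasure ?l ?B \<le> ennreal (avg_tail n K t) * emeasure ?l ?B" .
  then have "ennreal (\<rho> ^ n) * ennreal (5/324) \<le> ennreal (avg_tail n K t)"
    using emeasure_punctured_ball[OF dim]
    by (metis (no_types, lifting) ennreal_mult_le_mult_iff less_irrefl mult.commute)
  moreover have "0 \<le> avg_tail n K t" unfolding avg_tail_def by (intro Bochner_Integration.integral_nonneg) simp
  ultimately have bound: "\<rho> ^ n * (5/324) \<le> avg_tail n K t"
    using \<rho> by (subst (asm) ennreal_mult'[symmetric]) (simp_all add: ennreal_le_iff)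
  \<comment> \<open>Since \<open>t \<ge> 1\<close>, the constant \<open>5/324 \<ge> exp (- 7)\<close> is absorbed in the exponent.\<close>
  have "(2::real) ^ 7 \<le> exp 1 ^ 7"
    using exp_ge_add_one_self[of 1] by (intro power_mono) auto
  also have "\<dots> = exp 7" by (simp flip: exp_of_nat_mult)
  finally have "exp (- 7) \<le> (5/324 :: real)" by (simp add: exp_minus field_simps)
  moreover have "exp (- (1200 * t\<^sup>2)) \<le> \<rho> ^ n"
    using exp_le_power_one_minus[OF u, of n] n by (simp add: u_def \<rho>_def)
  ultimately have "exp (- (1200 * t\<^sup>2)) * exp (- 7) \<le> \<rho> ^ n * (5/324)"
    using \<rho> by (intro mult_mono) auto
  moreover have "exp (- (2500 * t\<^sup>2)) \<le> exp (- (1200 * t\<^sup>2)) * exp (- 7)"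
    using one_le_power[OF t, of 2] by (simp flip: exp_add)
  ultimately show ?thesis using bound by simp
qed

end

theorem theorem1p2:
  shows "\<exists>c::real. c > 0 \<and>
    (\<forall>n::nat. n \<ge> 1 \<longrightarrow>
      (\<forall>K::(nat \<Rightarrow> real) set. symmetric_body n K \<and> isotropic n K \<longrightarrow>
        (\<forall>t::real. 1 \<le> t \<and> t \<le> sqrt (real n) / c \<longrightarrow>
          avg_tail n K t \<ge> exp (- (c\<^sup>2 * t\<^sup>2)))))"
proof (intro exI[of _ 50] conjI allI impI)
  fix n :: nat and K :: "(nat \<Rightarrow> real) set" and t :: real
  assume n: "n \<ge> 1" and K: "symmetric_body n K \<and> isotropic n K" and t: "1 \<le> t \<and> t \<le> sqrt (real n) / 50"
  from K obtain L where L: "is_isotropic_constant n K L" by (auto simp: isotropic_def)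
  have vol: "measure (lebesgue_n n) K = 1" and "convex_n n K"
    using K by (auto simp: isotropic_def convex_body_def)
  have em: "emeasure (lebesgue_n n) K = 1"
    using vol by (metis emeasure_eq_ennreal_measure enn2real_top ennreal_1 measure_def zero_neq_one)
  \<comment> \<open>A set of positive measure is measurable, because non-measurable sets get measure 0.\<close>
  then have "K \<in> sets (lebesgue_n n)"
    using emeasure_notin_sets[of K "lebesgue_n n"] by auto
  then interpret isotropic_body n K L
    using n em L \<open>convex_n n K\<close> by unfold_locales
  have "(50 * t)\<^sup>2 \<le> (sqrt (real n))\<^sup>2"
    using t by (intro power_mono) auto
  then show "exp (- (50\<^sup>2 * t\<^sup>2)) \<le> avg_tail n K t"
    using avg_tail_lower_bound[of t] t by (simp add: power_mult_distrib)
qed simp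

end
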